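(* Let $D\ge2$ be an integer, let $\Lambda=\{1,\dots,k\}$, let $t_1,\dots,t_k\in\mathbb{R}$, and let $K\subset\mathbb{R}$ be the attractor of the IFS $\Phi=\{f_1,\dots,f_k\}$, where $f_i(x)=D^{-1}x+t_i$. Assume that $t_i-t_j\in\mathbb{Q}$ for every $i,j\in\Lambda$, and that $t_i$ is normal to base $D$ for some $i\in\Lambda$. Then for any $\Phi$-Bernoulli measure $\mu$ on $K$, $\mu$-a.e. $x\in K$ is normal to base $D$.
   Context: The attractor of the IFS $\Phi$ is the unique non-empty compact set $K$ with $K=\bigcup_{i\in\Lambda}f_i(K)$. The coding map is $\pi_\Phi:\Lambda^{\mathbb{N}}\to K$, $\pi_\Phi(i_1,i_2,\dots)=\lim_{n\to\infty}f_{i_1}\circ\cdots\circ f_{i_n}(0)$. A $\Phi$-Bernoulli measure is a measure of the form $(\pi_\Phi)_*P^{\otimes\mathbb{N}}$, where $P$ is a probability measure on $\Lambda$ with $P(\{i\})>0$ for all $i\in\Lambda$. A real number $x$ is normal to base $D$ if for every $n\in\mathbb{N}$ every word in $\{0,\dots,D-1\}^n$ occurs in the base $D$ expansion of $x$ with asymptotic frequency $D^{-n}$; equivalently, $(D^mx\bmod1)_m$ is equidistributed in $[0,1]$ with respect to Lebesgue measure. *)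

theory Defs
  imports "HOL-Probability.Probability"
begin

definition is_attractor :: "'i set \<Rightarrow> ('i \<Rightarrow> real \<Rightarrow> real) \<Rightarrow> real set \<Rightarrow> bool" where
  "is_attractor \<Lambda> f K \<longleftrightarrow> K \<noteq> {} \<and> compact K \<and> K = (\<Union>i\<in>\<Lambda>. f i ` K)"

(* Sequences are indexed from 0, so the n-th approximant is
   f (\<omega> 0) (f (\<omega> 1) (\<dots> (f (\<omega> (n - 1)) 0) \<dots>)). *)
definition coding_map :: "('i \<Rightarrow> real \<Rightarrow> real) \<Rightarrow> (nat \<Rightarrow> 'i) \<Rightarrow> real" where
  "coding_map f \<omega> = lim (\<lambda>n. foldr (\<lambda>j. f (\<omega> j)) [0..<n] 0)"

(* The probability P lives on the set \<Lambda> with its discrete sigma-algebra, so the product measure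
   lives on the sequences with values in \<Lambda>; its image is a Borel measure on the subspace K. *)
definition bernoulli_measure ::
  "'i set \<Rightarrow> ('i \<Rightarrow> real \<Rightarrow> real) \<Rightarrow> real set \<Rightarrow> real measure \<Rightarrow> bool" where
  "bernoulli_measure \<Lambda> f K \<mu> \<longleftrightarrow>
     (\<exists>P. prob_space P \<and> sets P = Pow \<Lambda> \<and> (\<forall>i\<in>\<Lambda>. measure P {i} > 0) \<and>
          \<mu> = distr (PiM (UNIV :: nat set) (\<lambda>_. P)) (restrict_space borel K) (coding_map f))"

(* The digit of index m (from 0) after the radix point in the base D expansion of the
   fractional part x - \<lfloor>x\<rfloor>, which is also what is expanded when x is negative. *)
definition base_digit :: "nat \<Rightarrow> real \<Rightarrow> nat \<Rightarrow> nat" where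
  "base_digit D x m = nat (\<lfloor>real D ^ Suc m * x\<rfloor> mod int D)"

definition normal_to_base :: "nat \<Rightarrow> real \<Rightarrow> bool" where
  "normal_to_base D x \<longleftrightarrow>
     (\<forall>w. set w \<subseteq> {0..<D} \<longrightarrow>
        (\<lambda>N. real (card {m. m < N \<and> (\<forall>j<length w. base_digit D x (m + j) = w ! j)}) / real N)
          \<longlonglongrightarrow> 1 / real D ^ length w)"

end

theory Submission
  imports Defs
begin

text \<open>
  Write e(x) for exp(2 \<pi> i x), the character of the circle \<real>/\<int>. By Weyl's criterion, x is normal to base
  D if and only if, for every integer h \<noteq> 0, the numbers e(h D^m x) average to 0 over m. Everything is
  done with these averages (\<open>weyl_criterion\<close>, \<open>normal_to_base_iff_weyl_criterion\<close>).

  A point of the attractor is x = \<Sum> D^(-n) t(\<omega> n), with \<omega> a Bernoulli sequence. Let t0 be a normal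
  translation and q a common denominator of the rationals t(i) - t0. Since \<Sum> D^(-n) = D / (D - 1),
  the integer Q = q (D - 1) clears all denominators: Q x = c + y(\<omega>), where c = q D t0 is a nonzero
  integer multiple of t0, hence satisfies Weyl's criterion, and y(\<omega>) = \<Sum> D^(-n) a(\<omega> n) has integer
  digits a. For such y, multiplication by D is the shift \<sigma> modulo 1, so
  e(h D^m Q x) = e(h D^m c) e(h y(\<sigma>^m \<omega>)). The first factor is deterministic and averages to 0. The
  second is a stationary bounded process whose correlations decay exponentially
  (\<open>shifted_character_correlations\<close>): it is its mean \<phi> plus a fluctuation. The term with \<phi> averages to
  0 because c satisfies the criterion. The fluctuation, multiplied by numbers of modulus 1, averages
  to 0 almost surely by the law of large numbers (\<open>AE_mean_zero_if_correlations_decay\<close>). So Q x is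
  almost surely normal (\<open>AE_weyl_add_digit_series\<close>).

  It remains to pass from Q x to x, which is a theorem of Wall (\<open>weyl_divide\<close>). For some s and p the
  integer Q divides D^s (D^p - 1). By van der Corput's inequality it is enough to control the
  correlations of e(h D^m x) at distances that are multiples of p. These are, up to a shift of the
  index by s, the sequences e(h' D^m Q x) with h' \<noteq> 0 an integer.
\<close>

section \<open>Sequences with mean zero and van der Corput's inequality\<close>

definition mean_zero :: "(nat \<Rightarrow> complex) \<Rightarrow> bool" where
  "mean_zero u \<longleftrightarrow> (\<lambda>N. (\<Sum>m<N. u m) / of_nat N) \<longlonglongrightarrow> 0"

lemma mean_zero_add:
  assumes "mean_zero u" "mean_zero v"
  shows "mean_zero (\<lambda>m. u m + v m)"
  using tendsto_add[OF assms[unfolded mean_zero_def]]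
  by (simp add: mean_zero_def sum.distrib add_divide_distrib)

lemma mean_zero_mult_left:
  assumes "mean_zero u"
  shows "mean_zero (\<lambda>m. c * u m)"
  using tendsto_mult_left[OF assms[unfolded mean_zero_def], of c]
  by (simp add: mean_zero_def sum_distrib_left)

lemma mean_zero_sum:
  assumes "\<And>i. i \<in> I \<Longrightarrow> mean_zero (u i)"
  shows "mean_zero (\<lambda>m. \<Sum>i\<in>I. u i m)"
  using assms
proof (induction I rule: infinite_finite_induct)
  case (insert i I)
  then show ?case by (simp add: mean_zero_add)
qed (simp_all add: mean_zero_def)

lemma mean_zero_cnj:
  assumes "mean_zero u"
  shows "mean_zero (\<lambda>m. cnj (u m))"
  using tendsto_cnj[OF assms[unfolded mean_zero_def]]
  by (simp add: mean_zero_def)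

lemma sum_lessThan_shift:
  fixes u :: "nat \<Rightarrow> 'a::ab_group_add"
  shows "(\<Sum>m<N. u (m + s)) = (\<Sum>m<N + s. u m) - (\<Sum>m<s. u m)"
  by (induction N) simp_all

lemma mean_zero_shift_iff: "mean_zero (\<lambda>m. u (m + s)) \<longleftrightarrow> mean_zero u"
proof -
  define S where "S = (\<lambda>N. \<Sum>m<N. u m)"
  have shifted: "(\<Sum>m<N. u (m + s)) = S (N + s) - S s" for N
    by (simp add: S_def sum_lessThan_shift)
  have const: "(\<lambda>N. c / of_nat N :: complex) \<longlonglongrightarrow> 0" for c
    by (rule lim_const_over_n)
  have ratio: "(\<lambda>N. of_nat (N + s) / of_nat N :: complex) \<longlonglongrightarrow> 1"
  proof -
    have "(\<lambda>N. 1 + of_nat s / of_nat N :: complex) \<longlonglongrightarrow> 1 + 0"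
      by (intro tendsto_add const tendsto_const)
    moreover have "\<forall>\<^sub>F N in sequentially. 1 + of_nat s / of_nat N = (of_nat (N + s) / of_nat N :: complex)"
      using eventually_gt_at_top[of 0] by eventually_elim (simp add: field_simps)
    ultimately show ?thesis by (simp add: tendsto_cong)
  qed
  have "mean_zero (\<lambda>m. u (m + s)) \<longleftrightarrow> (\<lambda>N. S (N + s) / of_nat N) \<longlonglongrightarrow> 0"
    unfolding mean_zero_def shifted
    using tendsto_add[OF _ const[of "S s"], of "\<lambda>N. (S (N + s) - S s) / of_nat N" 0]
      tendsto_diff[OF _ const[of "S s"], of "\<lambda>N. S (N + s) / of_nat N" 0]
    by (auto simp: diff_divide_distrib)
  also have "\<dots> \<longleftrightarrow> (\<lambda>N. S (N + s) / of_nat (N + s)) \<longlonglongrightarrow> 0"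
  proof
    assume "(\<lambda>N. S (N + s) / of_nat N) \<longlonglongrightarrow> 0"
    from tendsto_divide[OF this ratio]
    have "(\<lambda>N. S (N + s) / of_nat N / (of_nat (N + s) / of_nat N)) \<longlonglongrightarrow> 0" by simp
    then show "(\<lambda>N. S (N + s) / of_nat (N + s)) \<longlonglongrightarrow> 0"
      by (rule Lim_transform_eventually) (use eventually_gt_at_top[of 0] in eventually_elim, simp)
  next
    assume "(\<lambda>N. S (N + s) / of_nat (N + s)) \<longlonglongrightarrow> 0"
    from tendsto_mult[OF this ratio]
    have "(\<lambda>N. S (N + s) / of_nat (N + s) * (of_nat (N + s) / of_nat N)) \<longlonglongrightarrow> 0" by simp
    then show "(\<lambda>N. S (N + s) / of_nat N) \<longlonglongrightarrow> 0"
      by (rule Lim_transform_eventually)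
         (use eventually_gt_at_top[of 0] in eventually_elim, simp del: of_nat_add)
  qed
  also have "\<dots> \<longleftrightarrow> mean_zero u"
    unfolding mean_zero_def S_def
    using LIMSEQ_offset[of "\<lambda>N. (\<Sum>m<N. u m) / of_nat N" s 0]
      LIMSEQ_ignore_initial_segment[of "\<lambda>N. (\<Sum>m<N. u m) / of_nat N" 0 s] by blast
  finally show ?thesis .
qed

lemma mean_zero_approx:
  assumes "\<And>e. e > 0 \<Longrightarrow> \<exists>v. mean_zero v \<and> (\<forall>m. norm (u m - v m) \<le> e)"
  shows "mean_zero u"
  unfolding mean_zero_def tendsto_iff
proof (intro allI impI)
  fix e :: real assume "e > 0"
  then obtain v where v: "mean_zero v" "\<And>m. norm (u m - v m) \<le> e / 2"
    using assms[of "e / 2"] by auto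
  have "\<forall>\<^sub>F N in sequentially. norm ((\<Sum>m<N. v m) / of_nat N) < e / 2"
    using v(1) \<open>e > 0\<close> unfolding mean_zero_def tendsto_iff by (auto dest: spec[of _ "e / 2"])
  then show "\<forall>\<^sub>F N in sequentially. dist ((\<Sum>m<N. u m) / of_nat N) 0 < e"
    using eventually_gt_at_top[of 0]
  proof eventually_elim
    case (elim N)
    have "norm ((\<Sum>m<N. u m) / of_nat N - (\<Sum>m<N. v m) / of_nat N)
        = norm (\<Sum>m<N. u m - v m) / real N"
      by (simp add: sum_subtractf diff_divide_distrib[symmetric] norm_divide)
    also have "\<dots> \<le> (\<Sum>m<N. e / 2) / real N"
      by (intro divide_right_mono sum_norm_le v) auto
    also have "\<dots> = e / 2" using elim by simp
    finally show ?case
      using elim(1) norm_triangle_ineq2[of "(\<Sum>m<N. u m) / of_nat N" "(\<Sum>m<N. v m) / of_nat N"]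
      by simp
  qed
qed

text \<open>
  Up to a vanishing error, the average of u is the average of the block means
  (1/H) \<Sum>h<H. u (m + p h). By Cauchy-Schwarz its square is at most the average of the squares of
  these block means. Expanding the squares leaves a diagonal of size at most 1/H and correlations at
  distances p h with h \<ge> 1, which average to 0. The step p is kept because arithmetic information on
  the correlations is often available only along multiples of a period.
\<close>

lemma van_der_Corput:
  fixes p :: nat
  assumes bound: "\<And>m. norm (u m) \<le> 1"
    and corr: "\<And>h. h \<ge> 1 \<Longrightarrow> mean_zero (\<lambda>m. u (m + p * h) * cnj (u m))"
  shows "mean_zero u"
proof -
  define W where "W = (\<lambda>H m. \<Sum>h<H. u (m + p * h))"
  have off_diagonal: "mean_zero (\<lambda>m. u (m + p * h) * cnj (u (m + p * h')))" if "h \<noteq> h'" for h h'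
  proof -
    have *: "mean_zero (\<lambda>m. u (m + p * h) * cnj (u (m + p * h')))" if "h' < h" for h h'
    proof -
      have "mean_zero (\<lambda>m. u ((m + p * h') + p * (h - h')) * cnj (u (m + p * h')))"
        by (rule mean_zero_shift_iff[of "\<lambda>m. u (m + p * (h - h')) * cnj (u m)", THEN iffD2])
           (use that corr in simp)
      moreover have "p * h' + p * (h - h') = p * h"
        using that by (metis add_mult_distrib2 le_add_diff_inverse less_imp_le)
      ultimately show ?thesis by (simp add: add.assoc)
    qed
    show ?thesis
      using *[of h' h] mean_zero_cnj[OF *[of h h']] that by (cases "h' < h") (auto simp: mult.commute)
  qed
  have square: "mean_zero (\<lambda>m. W H m * cnj (W H m) - (\<Sum>h<H. u (m + p * h) * cnj (u (m + p * h))))" for H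
  proof -
    have "W H m * cnj (W H m) - (\<Sum>h<H. u (m + p * h) * cnj (u (m + p * h)))
        = (\<Sum>h<H. \<Sum>h'\<in>{..<H} - {h}. u (m + p * h) * cnj (u (m + p * h')))" for m
      unfolding W_def cnj_sum sum_product sum_subtractf[symmetric]
      by (intro sum.cong refl) (simp add: sum_diff1)
    then show ?thesis
      by (simp only:) (intro mean_zero_sum off_diagonal, auto)
  qed
  have mean_W: "mean_zero (\<lambda>m. W H m - of_nat H * u m)" for H
  proof -
    have "mean_zero (\<lambda>m. u (m + s) - u m)" for s
    proof -
      have "(\<Sum>m<N. u (m + s) - u m) = (\<Sum>m<s. u (m + N) - u m)" for N
        by (simp add: sum_subtractf sum_lessThan_shift add.commute)
      moreover have "norm (u i - u j) \<le> 2" for i j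
        using norm_triangle_ineq4[of "u i" "u j"] bound[of i] bound[of j] by simp
      ultimately have "norm (\<Sum>m<N. u (m + s) - u m) \<le> (\<Sum>m<s. 2)" for N
        by (simp only:) (intro sum_norm_le)
      then have "norm ((\<Sum>m<N. u (m + s) - u m) / of_nat N) \<le> (2 * real s) / real N" for N
        by (simp add: norm_divide divide_right_mono mult.commute)
      then show ?thesis unfolding mean_zero_def
        by (rule Lim_null_comparison[OF always_eventually[OF allI] lim_const_over_n])
    qed
    then have "mean_zero (\<lambda>m. \<Sum>h<H. u (m + p * h) - u m)" by (intro mean_zero_sum)
    then show ?thesis by (simp add: W_def sum_subtractf)
  qed
  show ?thesis unfolding mean_zero_def tendsto_iff
  proof (intro allI impI)
    fix e :: real assume "e > 0"
    \<comment> \<open>H is chosen so that the diagonal term, of order 1 / sqrt H, is smaller than e.\<close>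
    obtain H :: nat where H: "(3 / e)\<^sup>2 < real H"
      using reals_Archimedean2 by blast
    have "H > 0" using H by (cases H) auto
    have "3 / e < sqrt (real H)" using H \<open>e > 0\<close> by (intro real_less_rsqrt) auto
    then have small: "3 < e * sqrt (real H)" using \<open>e > 0\<close> by (simp add: field_simps)
    define a where "a = (\<lambda>N. (\<Sum>m<N. u m) / of_nat N)"
    define w where "w = (\<lambda>N. (\<Sum>m<N. W H m) / of_nat N)"
    have "\<forall>\<^sub>F N in sequentially. norm ((\<Sum>m<N. W H m - of_nat H * u m) / of_nat N) < 1"
      using mean_W[of H] unfolding mean_zero_def tendsto_iff by (auto dest: spec[of _ 1])
    moreover have "\<forall>\<^sub>F N in sequentially.
       norm ((\<Sum>m<N. W H m * cnj (W H m) - (\<Sum>h<H. u (m + p * h) * cnj (u (m + p * h)))) / of_nat N) < real H"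
      using square[of H] \<open>H > 0\<close> unfolding mean_zero_def tendsto_iff by (auto dest: spec[of _ "real H"])
    ultimately show "\<forall>\<^sub>F N in sequentially. dist ((\<Sum>m<N. u m) / of_nat N) 0 < e"
      using eventually_gt_at_top[of 0]
    proof eventually_elim
      case (elim N)
      define q where "q = (\<Sum>m<N. (norm (W H m))\<^sup>2)"
      define d where "d = (\<Sum>m<N. \<Sum>h<H. (norm (u (m + p * h)))\<^sup>2)"
      have "d \<le> (\<Sum>m<N. \<Sum>h<H. 1)"
        unfolding d_def by (intro sum_mono power_le_one bound) auto
      then have d: "d \<le> real N * real H" by simp
      have "(\<Sum>m<N. W H m * cnj (W H m) - (\<Sum>h<H. u (m + p * h) * cnj (u (m + p * h)))) = of_real (q - d)"
        by (simp only: q_def d_def sum_subtractf complex_norm_square[symmetric] of_real_diff of_real_sum)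
      with elim(2) have "\<bar>q - d\<bar> / real N < real H"
        by (simp add: norm_divide flip: of_real_diff)
      then have "\<bar>q - d\<bar> < real H * real N" using elim(3) by (simp add: divide_less_eq)
      with d have q: "q \<le> 2 * real H * real N" by (simp add: algebra_simps)
      have "(norm (w N))\<^sup>2 \<le> ((\<Sum>m<N. norm (W H m)) / real N)\<^sup>2"
        unfolding w_def norm_divide by (intro power_mono) (auto intro: divide_right_mono sum_norm_le)
      also have "\<dots> \<le> q * real N / (real N)\<^sup>2"
        using sum_squared_le_sum_of_squares[of "\<lambda>m. norm (W H m)" "{..<N}"]
        unfolding power_divide q_def by (intro divide_right_mono) auto
      also have "\<dots> \<le> (2 * real H * real N) * real N / (real N)\<^sup>2"
        by (intro divide_right_mono mult_right_mono q) auto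
      also have "\<dots> \<le> (2 * sqrt (real H))\<^sup>2"
        using elim(3) by (simp add: power2_eq_square)
      finally have w: "norm (w N) \<le> 2 * sqrt (real H)"
        by (rule power2_le_imp_le) simp
      have "norm (w N - of_nat H * a N) < 1"
        using elim(1) by (simp add: w_def a_def sum_subtractf sum_distrib_left diff_divide_distrib)
      moreover have "norm (of_nat H * a N) \<le> norm (w N) + norm (w N - of_nat H * a N)"
        using norm_triangle_ineq4[of "w N" "w N - of_nat H * a N"] by simp
      ultimately have "real H * norm (a N) < 1 + 2 * sqrt (real H)"
        using w by (simp add: norm_mult)
      also have "\<dots> \<le> 3 * sqrt (real H)" using \<open>H > 0\<close> by simp
      also have "\<dots> < e * sqrt (real H) * sqrt (real H)"
        using small \<open>H > 0\<close> by (intro mult_strict_right_mono) auto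
      also have "\<dots> = real H * e" by simp
      finally show ?case using \<open>H > 0\<close> by (simp add: a_def)
    qed
  qed
qed

section \<open>The character of the circle and trigonometric polynomials\<close>

text \<open>
  The standard character e(x) = exp (2 \<pi> i x) of \<real>/\<int>. Writing it with cis keeps the argument real.
\<close>

definition circle_char :: "real \<Rightarrow> complex" where
  "circle_char x = cis (2 * pi * x)"

lemma norm_circle_char [simp]: "norm (circle_char x) = 1"
  by (simp add: circle_char_def)

lemma circle_char_0 [simp]: "circle_char 0 = 1"
  by (simp add: circle_char_def)

lemma circle_char_add: "circle_char (x + y) = circle_char x * circle_char y"
  by (simp add: circle_char_def cis_mult distrib_left)

lemma circle_char_minus: "circle_char (- x) = cnj (circle_char x)"
  by (simp add: circle_char_def cis_cnj)

lemma circle_char_diff: "circle_char (x - y) = circle_char x * cnj (circle_char y)"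
  using circle_char_add[of x "- y"] by (simp add: circle_char_minus)

lemma circle_char_int [simp]: "n \<in> \<int> \<Longrightarrow> circle_char n = 1"
  by (simp add: circle_char_def)

lemma circle_char_add_int: "n \<in> \<int> \<Longrightarrow> circle_char (x + n) = circle_char x"
  by (simp add: circle_char_add)

lemma circle_char_power: "circle_char x ^ n = circle_char (real n * x)"
  using Complex.DeMoivre[of "2 * pi * x" n] by (simp only: circle_char_def mult_ac)

lemma circle_char_powi: "circle_char x powi k = circle_char (of_int k * x)"
proof (cases "k \<ge> 0")
  case False
  have "inverse (circle_char x) = circle_char (- x)" by (simp add: circle_char_def)
  with False show ?thesis by (simp add: power_int_def circle_char_power)
qed (simp add: power_int_def circle_char_power)

lemma circle_char_eq_1_iff: "circle_char x = 1 \<longleftrightarrow> x \<in> \<int>"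
proof
  assume "circle_char x = 1"
  then have "cos (2 * pi * x) = 1" by (simp add: circle_char_def complex_eq_iff)
  then obtain n :: int where "2 * pi * x = of_int n * 2 * pi" by (auto simp: cos_one_2pi_int)
  then have "x = of_int n" by simp
  then show "x \<in> \<int>" by simp
qed simp

text \<open>
  Allows a sequence to be replaced by a nearby one before averaging: the error in the averages is
  bounded by the distance of the arguments.
\<close>

lemma circle_char_lipschitz: "norm (circle_char x - circle_char y) \<le> 2 * pi * \<bar>x - y\<bar>"
proof -
  have "norm (circle_char (x - y) - 1) \<le> 2 * pi * \<bar>x - y\<bar>"
    using iexp_approx1[of "2 * pi * (x - y)" 0] by (simp add: circle_char_def cis_conv_exp abs_mult)
  moreover have "circle_char x - circle_char y = circle_char y * (circle_char (x - y) - 1)"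
    using circle_char_add[of y "x - y"] by (simp add: algebra_simps)
  ultimately show ?thesis by (simp add: norm_mult)
qed

lemma sum_roots_of_unity:
  assumes "R > 0" "\<not> int R dvd k"
  shows "(\<Sum>j<R. circle_char (of_int k * (real j / real R))) = 0"
proof -
  define z where "z = circle_char (of_int k / real R)"
  have "z \<noteq> 1"
  proof
    assume "z = 1"
    then obtain n where "of_int k / real R = of_int n"
      by (auto simp: z_def circle_char_eq_1_iff elim: Ints_cases)
    then have "real_of_int k = of_int (n * int R)" using assms by (simp add: field_simps)
    then have "k = n * int R" by (simp only: of_int_eq_iff)
    then show False using assms by simp
  qed
  moreover have "z ^ R = 1" using assms by (simp add: z_def circle_char_power)
  moreover have "(\<Sum>j<R. circle_char (of_int k * (real j / real R))) = (\<Sum>j<R. z ^ j)"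
    by (simp add: z_def circle_char_power mult_ac)
  ultimately show ?thesis using geometric_sum[of z R] by simp
qed

text \<open>
  Laurent polynomials in z, to be evaluated on the unit circle. Generating them from monomials by
  addition makes every linear property a two-case induction.
\<close>

inductive trig_poly :: "(complex \<Rightarrow> complex) \<Rightarrow> bool" where
  monomial: "trig_poly (\<lambda>z. c * z powi k)"
| add: "trig_poly p \<Longrightarrow> trig_poly q \<Longrightarrow> trig_poly (\<lambda>z. p z + q z)"

lemma trig_poly_mult:
  assumes "trig_poly p" "trig_poly q"
  shows "\<exists>r. trig_poly r \<and> (\<forall>z\<noteq>0. r z = p z * q z)"
  using assms(1)
proof induction
  case (monomial c k)
  show ?case using assms(2)
  proof induction
    case (monomial d l)
    show ?case
      by (rule exI[of _ "\<lambda>z. (c * d) * z powi (k + l)"])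
         (auto intro!: trig_poly.monomial simp: power_int_add)
  next
    case (add q1 q2)
    then obtain r1 r2 where "trig_poly r1" "trig_poly r2"
      "\<forall>z\<noteq>0. r1 z = c * z powi k * q1 z" "\<forall>z\<noteq>0. r2 z = c * z powi k * q2 z" by blast
    then show ?case
      by (intro exI[of _ "\<lambda>z. r1 z + r2 z"]) (auto intro: trig_poly.add simp: distrib_left)
  qed
next
  case (add p1 p2)
  then obtain r1 r2 where "trig_poly r1" "trig_poly r2"
    "\<forall>z\<noteq>0. r1 z = p1 z * q z" "\<forall>z\<noteq>0. r2 z = p2 z * q z" by blast
  then show ?case
    by (intro exI[of _ "\<lambda>z. r1 z + r2 z"]) (auto intro: trig_poly.add simp: distrib_right)
qed

text \<open>
  On the unit circle the conjugate of z is 1/z, so Re z and Im z, and with them all real polynomials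
  in these coordinates, are Laurent polynomials in z. This turns the Stone-Weierstrass theorem into
  the density of trigonometric polynomials.
\<close>

lemma real_polynomial_function_eq_trig_poly:
  fixes f :: "complex \<Rightarrow> real"
  assumes "real_polynomial_function f"
  shows "\<exists>p. trig_poly p \<and> (\<forall>z\<in>sphere 0 1. of_real (f z) = p z)"
  using assms
proof induction
  case (linear f)
  then interpret bounded_linear f .
  define a b where "a = f 1" and "b = f \<i>"
  have f: "f z = Re z * a + Im z * b" for z
  proof -
    have "f z = f (Re z *\<^sub>R 1 + Im z *\<^sub>R \<i>)"
      by (rule arg_cong[where f = f]) (simp add: complex_eq_iff)
    then show ?thesis by (simp add: add scaleR a_def b_def)
  qed
  define p where "p = (\<lambda>z. ((a - b * \<i>) / 2) * z powi 1 + ((a + b * \<i>) / 2) * z powi (- 1))"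
  have "of_real (f z) = p z" if "z \<in> sphere 0 1" for z
  proof -
    have "norm z = 1" using that by simp
    then have "z * cnj z = 1" by (simp flip: complex_norm_square)
    then have "inverse z = cnj z" by (metis inverse_unique)
    then have "p z = (a - b * \<i>) / 2 * z + (a + b * \<i>) / 2 * cnj z"
      by (simp add: p_def power_int_minus)
    then show ?thesis by (simp add: f complex_eq_iff field_simps)
  qed
  moreover have "trig_poly p" unfolding p_def by (intro trig_poly.intros)
  ultimately show ?case by blast
next
  case (const c)
  show ?case
    by (intro exI[of _ "\<lambda>z. of_real c * z powi 0"] conjI trig_poly.monomial) simp
next
  case (add f g)
  then obtain p q where "trig_poly p" "trig_poly q" "\<forall>z\<in>sphere 0 1. of_real (f z) = p z"
    "\<forall>z\<in>sphere 0 1. of_real (g z) = q z" by blast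
  then show ?case
    by (intro exI[of _ "\<lambda>z. p z + q z"] conjI trig_poly.add) simp_all
next
  case (mult f g)
  then obtain p q where pq: "trig_poly p" "trig_poly q" "\<forall>z\<in>sphere 0 1. of_real (f z) = p z"
    "\<forall>z\<in>sphere 0 1. of_real (g z) = q z" by blast
  then obtain r where "trig_poly r" "\<forall>z\<noteq>0. r z = p z * q z" using trig_poly_mult by blast
  moreover have "z \<noteq> 0" if "z \<in> sphere 0 1" for z :: complex
    using that by auto
  ultimately show ?case
    using pq by (intro exI[of _ r] conjI ballI) simp_all
qed

section \<open>Weyl's criterion for equidistribution\<close>

definition weyl_criterion :: "(nat \<Rightarrow> real) \<Rightarrow> bool" where
  "weyl_criterion y \<longleftrightarrow> (\<forall>k. k \<noteq> 0 \<longrightarrow> mean_zero (\<lambda>m. circle_char (of_int k * y m)))"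

text \<open>
  The limit c is the constant coefficient of p. The R-th roots of unity compute the same number
  exactly as soon as R exceeds the degree, so averages over roots of unity can stand for integrals
  over the circle.
\<close>

lemma weyl_trig_poly:
  assumes "weyl_criterion y" "trig_poly p"
  shows "\<exists>c R0. mean_zero (\<lambda>m. p (circle_char (y m)) - c) \<and>
    (\<forall>R>R0. (\<Sum>j<R. p (circle_char (real j / real R))) / of_nat R = c)"
  using assms(2)
proof induction
  case (monomial a k)
  show ?case
  proof (cases "k = 0")
    case True
    then show ?thesis by (intro exI[of _ a] exI[of _ 0]) (simp add: mean_zero_def)
  next
    case False
    have "mean_zero (\<lambda>m. a * circle_char (y m) powi k - 0)"
      using assms(1) False by (auto simp: weyl_criterion_def circle_char_powi intro: mean_zero_mult_left)
    moreover have "(\<Sum>j<R. a * circle_char (real j / real R) powi k) / of_nat R = 0" if "R > nat \<bar>k\<bar>" for R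
    proof -
      have "\<not> int R dvd k" using that False zdvd_not_zless[of "\<bar>k\<bar>" "int R"] by auto
      then show ?thesis
        using that sum_roots_of_unity[of R k] by (simp add: circle_char_powi flip: sum_distrib_left)
    qed
    ultimately show ?thesis by blast
  qed
next
  case (add p q)
  then obtain c R c' R' where "mean_zero (\<lambda>m. p (circle_char (y m)) - c)" "mean_zero (\<lambda>m. q (circle_char (y m)) - c')"
    "\<forall>S>R. (\<Sum>j<S. p (circle_char (real j / real S))) / of_nat S = c"
    "\<forall>S>R'. (\<Sum>j<S. q (circle_char (real j / real S))) / of_nat S = c'" by blast
  note pq = this
  have "mean_zero (\<lambda>m. p (circle_char (y m)) + q (circle_char (y m)) - (c + c'))"
    using mean_zero_add[OF pq(1,2)] by (simp add: algebra_simps)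
  moreover have "(\<Sum>j<S. p (circle_char (real j / real S)) + q (circle_char (real j / real S))) / of_nat S = c + c'"
    if "S > max R R'" for S
    using pq(3,4) that by (simp add: sum.distrib add_divide_distrib)
  ultimately show ?case by blast
qed

lemma weyl_continuous:
  fixes g :: "complex \<Rightarrow> real"
  assumes "weyl_criterion y" "continuous_on (sphere 0 1) g" "e > 0"
  shows "\<exists>R0. \<forall>R>R0. \<forall>\<^sub>F N in sequentially.
    \<bar>(\<Sum>m<N. g (circle_char (y m))) / real N - (\<Sum>j<R. g (circle_char (real j / real R))) / real R\<bar> < e"
proof -
  obtain f where f: "real_polynomial_function f" "\<And>z. z \<in> sphere 0 1 \<Longrightarrow> \<bar>g z - f z\<bar> < e / 3"
    using Stone_Weierstrass_real_polynomial_function[OF compact_sphere assms(2), of "e / 3"] \<open>e > 0\<close>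
    by auto
  obtain p where p: "trig_poly p" "\<forall>z\<in>sphere 0 1. of_real (f z) = p z"
    using real_polynomial_function_eq_trig_poly[OF f(1)] by blast
  obtain c R0 where c: "mean_zero (\<lambda>m. p (circle_char (y m)) - c)"
    "\<And>R. R > R0 \<Longrightarrow> (\<Sum>j<R. p (circle_char (real j / real R))) / of_nat R = c"
    using weyl_trig_poly[OF assms(1) p(1)] by blast
  have fp: "p (circle_char t) = of_real (f (circle_char t))" for t
    using p(2) by simp
  have avg: "\<bar>(\<Sum>m<N. g (circle_char (t m))) / real N - (\<Sum>m<N. f (circle_char (t m))) / real N\<bar> \<le> e / 3"
    if "N > 0" for N and t :: "nat \<Rightarrow> real"
  proof -
    have "\<bar>\<Sum>m<N. g (circle_char (t m)) - f (circle_char (t m))\<bar> \<le> (\<Sum>m<N. e / 3)"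
      unfolding real_norm_def[symmetric]
    proof (intro sum_norm_le)
      fix m show "norm (g (circle_char (t m)) - f (circle_char (t m))) \<le> e / 3"
        using f(2)[of "circle_char (t m)"] by simp
    qed
    then show ?thesis
      using that by (simp add: sum_subtractf diff_divide_distrib[symmetric] abs_divide divide_le_eq mult_ac)
  qed
  show ?thesis
  proof (intro exI[of _ R0] allI impI)
    fix R assume R: "R > R0"
    define r where "r = (\<Sum>j<R. f (circle_char (real j / real R))) / real R"
    have r: "c = of_real r" using c(2)[OF R] by (simp add: r_def fp)
    have "\<forall>\<^sub>F N in sequentially. norm ((\<Sum>m<N. p (circle_char (y m)) - c) / of_nat N) < e / 3"
      using c(1) \<open>e > 0\<close> unfolding mean_zero_def tendsto_iff by (auto dest: spec[of _ "e / 3"])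
    then show "\<forall>\<^sub>F N in sequentially.
      \<bar>(\<Sum>m<N. g (circle_char (y m))) / real N - (\<Sum>j<R. g (circle_char (real j / real R))) / real R\<bar> < e"
      using eventually_gt_at_top[of 0]
    proof eventually_elim
      case (elim N)
      have "(\<Sum>m<N. p (circle_char (y m)) - c) / of_nat N = of_real ((\<Sum>m<N. f (circle_char (y m))) / real N - r)"
        using elim(2) by (simp add: fp r sum_subtractf diff_divide_distrib)
      then have "\<bar>(\<Sum>m<N. f (circle_char (y m))) / real N - r\<bar> < e / 3"
        using elim(1) by (simp only: norm_of_real)
      then show ?case
        using avg[OF elim(2), of y] avg[of R "\<lambda>j. real j / real R"] R unfolding r_def by linarith
    qed
  qed
qed

lemma card_ints_in_interval:
  fixes a b :: real
  assumes "b > 0"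
  shows "finite {l::int. \<bar>of_int l - a\<bar> < b}" "real (card {l::int. \<bar>of_int l - a\<bar> < b}) \<le> 2 * b + 1"
proof -
  have sub: "{l::int. \<bar>of_int l - a\<bar> < b} \<subseteq> {\<lceil>a - b\<rceil>..\<lfloor>a + b\<rfloor>}"
    by (auto simp: ceiling_le_iff le_floor_iff)
  then show "finite {l::int. \<bar>of_int l - a\<bar> < b}" by (rule finite_subset) simp
  have "real (card {l::int. \<bar>of_int l - a\<bar> < b}) \<le> real (card {\<lceil>a - b\<rceil>..\<lfloor>a + b\<rfloor>})"
    by (intro of_nat_mono card_mono sub) simp
  also have "\<dots> \<le> 2 * b + 1"
    using assms by (simp add: of_nat_nat) linarith
  finally show "real (card {l::int. \<bar>of_int l - a\<bar> < b}) \<le> 2 * b + 1" .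
qed

text \<open>
  Here j/R is regarded as a point of the circle, so the arc of radius b around c consists of all
  translates by integers n. Subtracting n R from j injects the points into the integers of a real
  interval of length 2 b R.
\<close>

lemma card_equispaced_in_arc:
  fixes c b :: real and R :: nat
  assumes "R > 0" "b > 0"
  shows "real (card {j. j < R \<and> (\<exists>n::int. \<bar>real j / real R - c - of_int n\<bar> < b)}) \<le> 2 * b * real R + 1"
    (is "real (card ?A) \<le> _")
proof -
  obtain n where n: "\<And>j. j \<in> ?A \<Longrightarrow> \<bar>real j / real R - c - of_int (n j)\<bar> < b"
    by atomize_elim (intro choice, auto)
  define h where "h = (\<lambda>j. int j - n j * int R)"
  have "inj_on h ?A"
  proof (rule inj_onI)
    fix i j assume ij: "i \<in> ?A" "j \<in> ?A" "h i = h j"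
    have "int k = h k mod int R" if "k < R" for k
    proof -
      have "h k mod int R = int k mod int R"
        unfolding h_def by (metis mod_mult_self4 diff_add_cancel add.commute mod_mult_self3)
      then show ?thesis using that by simp
    qed
    from this[of i] this[of j] ij show "i = j" by auto
  qed
  then have "card ?A = card (h ` ?A)" by (simp add: card_image)
  also have "\<dots> \<le> card {l::int. \<bar>of_int l - real R * c\<bar> < b * real R}"
  proof (intro card_mono card_ints_in_interval)
    show "h ` ?A \<subseteq> {l::int. \<bar>of_int l - real R * c\<bar> < b * real R}"
    proof clarify
      fix j n' assume "j < R" "\<bar>real j / real R - c - of_int n'\<bar> < b"
      then have "\<bar>real j / real R - c - of_int (n j)\<bar> < b" by (intro n) auto
      then have "\<bar>real j / real R - c - of_int (n j)\<bar> * real R < b * real R"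
        using assms by (intro mult_strict_right_mono) auto
      also have "\<bar>real j / real R - c - of_int (n j)\<bar> * real R
          = \<bar>(real j / real R - c - of_int (n j)) * real R\<bar>"
        by (simp add: abs_mult)
      also have "(real j / real R - c - of_int (n j)) * real R = of_int (h j) - real R * c"
        using assms by (simp add: h_def field_simps)
      finally show "\<bar>of_int (h j) - real R * c\<bar> < b * real R" .
    qed
  qed (use assms in simp)
  finally show ?thesis
    using card_ints_in_interval(2)[of "b * real R" "real R * c"] assms by simp
qed

text \<open>
  The indicator of the arc is bounded by a continuous function supported in a slightly larger arc,
  whose average is computed by counting roots of unity. Only an upper bound is needed: the arcs used
  below partition the circle, and their frequencies add up to 1.
\<close>

lemma weyl_arc_upper_bound:
  fixes c b e :: real
  assumes "weyl_criterion y" "b \<ge> 0" "e > 0"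
  shows "\<forall>\<^sub>F N in sequentially.
    real (card {m. m < N \<and> (\<exists>n::int. \<bar>y m - c - of_int n\<bar> \<le> b)}) / real N < 2 * b + e"
proof -
  \<comment> \<open>For d > 1/2 the claimed bound exceeds 1; otherwise d is the radius of the larger arc.\<close>
  define d where "d = b + e / 4"
  have "d > b" "d > 0" using assms by (auto simp: d_def)
  show ?thesis
  proof (cases "d \<le> 1 / 2")
    case False
    show ?thesis
      using eventually_gt_at_top[of 0]
    proof eventually_elim
      case (elim N)
      have "card {m. m < N \<and> (\<exists>n::int. \<bar>y m - c - of_int n\<bar> \<le> b)} \<le> card {..<N}"
        by (intro card_mono) auto
      then have "real (card {m. m < N \<and> (\<exists>n::int. \<bar>y m - c - of_int n\<bar> \<le> b)}) / real N \<le> 1"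
        using elim by (simp add: divide_le_eq)
      then show ?case using False assms by (simp add: d_def)
    qed
  next
    case True
    define hi lo where "hi = cos (2 * pi * b)" and "lo = cos (2 * pi * d)"
    have "lo < hi"
      unfolding hi_def lo_def using \<open>d > b\<close> True assms
      by (intro cos_monotone_0_pi) auto
    \<comment> \<open>On the circle the distance to c is measured by the cosine of the angle, so g is a function of the inner product of z with the centre of the arc that is 1 on the arc of radius b and 0 off the arc of radius d.\<close>
    define g where "g = (\<lambda>z. max 0 (min 1 ((Re (z * cnj (circle_char c)) - lo) / (hi - lo))))"
    have Re: "Re (circle_char t * cnj (circle_char c)) = cos (2 * pi * \<bar>t - c - of_int n\<bar>)" for t and n :: int
    proof -
      have "circle_char t * cnj (circle_char c) = circle_char (t - c - of_int n)"
        by (simp add: circle_char_diff)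
      also have "Re \<dots> = cos \<bar>2 * pi * (t - c - of_int n)\<bar>"
        by (simp only: circle_char_def cis.sel cos_abs_real)
      also have "\<dots> = cos (2 * pi * \<bar>t - c - of_int n\<bar>)"
        by (simp add: abs_mult)
      finally show ?thesis .
    qed
    have g_bounds: "0 \<le> g z" "g z \<le> 1" for z
      by (auto simp: g_def)
    have g_one: "g (circle_char t) = 1" if "\<bar>t - c - of_int n\<bar> \<le> b" for t and n :: int
    proof -
      have "hi \<le> cos (2 * pi * \<bar>t - c - of_int n\<bar>)"
        unfolding hi_def using that True \<open>d > b\<close> by (intro cos_monotone_0_pi_le) auto
      then have "1 \<le> (cos (2 * pi * \<bar>t - c - of_int n\<bar>) - lo) / (hi - lo)"
        using \<open>lo < hi\<close> by simp
      then show ?thesis unfolding g_def Re[of t n] by simp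
    qed
    have g_supp: "\<exists>n::int. \<bar>t - c - of_int n\<bar> < d" if "g (circle_char t) \<noteq> 0" for t
    proof (intro exI)
      let ?s = "\<bar>t - c - of_int (round (t - c))\<bar>"
      have "?s \<le> 1 / 2" using of_int_round_abs_le[of "t - c"] by (simp add: abs_minus_commute)
      moreover have "lo < cos (2 * pi * ?s)"
      proof -
        have "\<not> (cos (2 * pi * ?s) - lo) / (hi - lo) \<le> 0"
          using that unfolding g_def Re[of t "round (t - c)"] by auto
        then show ?thesis using \<open>lo < hi\<close> by (simp add: divide_le_0_iff)
      qed
      ultimately have "2 * pi * ?s < 2 * pi * d"
        using True \<open>d > 0\<close> by (subst cos_mono_less_eq[symmetric]) (auto simp: lo_def)
      then show "?s < d" by simp
    qed
    have "continuous_on (sphere 0 1) g"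
      unfolding g_def using \<open>lo < hi\<close> by (intro continuous_intros) auto
    from weyl_continuous[OF assms(1) this, of "e / 8"] \<open>e > 0\<close> obtain R0 where R0:
      "\<And>R. R > R0 \<Longrightarrow> \<forall>\<^sub>F N in sequentially.
         \<bar>(\<Sum>m<N. g (circle_char (y m))) / real N - (\<Sum>j<R. g (circle_char (real j / real R))) / real R\<bar> < e / 8"
      by auto
    obtain R where R: "R > R0" "8 / e < real R"
      using reals_Archimedean2[of "max (8 / e) (real R0)"] by auto
    then have "R > 0" by auto
    have "(\<Sum>j<R. g (circle_char (real j / real R)))
        \<le> (\<Sum>j<R. if \<exists>n::int. \<bar>real j / real R - c - of_int n\<bar> < d then 1 else 0)"
    proof (intro sum_mono)
      fix j
      show "g (circle_char (real j / real R))
          \<le> (if \<exists>n::int. \<bar>real j / real R - c - of_int n\<bar> < d then 1 else 0)"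
        using g_bounds(2) g_supp[of "real j / real R"]
        by (cases "g (circle_char (real j / real R)) = 0") auto
    qed
    also have "\<dots> = real (card {j. j < R \<and> (\<exists>n::int. \<bar>real j / real R - c - of_int n\<bar> < d)})"
      by (subst sum.If_cases) (auto intro!: arg_cong[where f = card])
    also have "\<dots> \<le> 2 * d * real R + 1"
      by (rule card_equispaced_in_arc) fact+
    finally have "(\<Sum>j<R. g (circle_char (real j / real R))) / real R \<le> 2 * d + 1 / real R"
      using \<open>R > 0\<close> by (simp add: field_simps)
    also have "1 / real R < e / 8" using R \<open>R > 0\<close> \<open>e > 0\<close> by (simp add: field_simps)
    finally have bound: "(\<Sum>j<R. g (circle_char (real j / real R))) / real R < 2 * d + e / 8" by simp
    from R0[OF R(1)] show ?thesis
    proof eventually_elim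
      case (elim N)
      have "real (card {m. m < N \<and> (\<exists>n::int. \<bar>y m - c - of_int n\<bar> \<le> b)})
          = (\<Sum>m<N. if \<exists>n::int. \<bar>y m - c - of_int n\<bar> \<le> b then 1 else 0)"
        by (subst sum.If_cases) (auto intro!: arg_cong[where f = card])
      also have "\<dots> \<le> (\<Sum>m<N. g (circle_char (y m)))"
        using g_bounds g_one by (intro sum_mono) auto
      finally have "real (card {m. m < N \<and> (\<exists>n::int. \<bar>y m - c - of_int n\<bar> \<le> b)}) / real N
          \<le> (\<Sum>m<N. g (circle_char (y m))) / real N"
        by (intro divide_right_mono) auto
      also have "\<dots> < 2 * d + e / 8 + e / 8"
        using elim bound by (simp only: abs_less_iff) linarith
      also have "\<dots> < 2 * b + e"
        using \<open>e > 0\<close> by (simp add: d_def)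
      finally show ?case .
    qed
  qed
qed

text \<open>
  The number \<open>\<lfloor>M y\<rfloor> mod M\<close> is the index J of the interval [J/M, (J+1)/M) that contains the fractional
  part of y. For y = D^m x and M = D^L it encodes the L base D digits of x that follow position m.
\<close>

definition block_freq :: "(nat \<Rightarrow> real) \<Rightarrow> nat \<Rightarrow> nat \<Rightarrow> nat \<Rightarrow> real" where
  "block_freq y M J N = real (card {m. m < N \<and> \<lfloor>real M * y m\<rfloor> mod int M = int J}) / real N"

lemma sum_by_blocks:
  fixes F :: "nat \<Rightarrow> 'a::real_vector"
  assumes "M > 0"
  shows "(\<Sum>m<N. F (nat (\<lfloor>real M * y m\<rfloor> mod int M))) /\<^sub>R real N
    = (\<Sum>J<M. block_freq y M J N *\<^sub>R F J)"
proof -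
  define \<beta> where "\<beta> = (\<lambda>m. nat (\<lfloor>real M * y m\<rfloor> mod int M))"
  have \<beta>: "\<beta> m < M" for m
    using assms by (simp add: \<beta>_def nat_less_iff)
  have eq: "{m. m < N \<and> \<lfloor>real M * y m\<rfloor> mod int M = int J} = {m \<in> {..<N}. \<beta> m = J}" for J
    using assms by (auto simp: \<beta>_def)
  have "(\<Sum>m<N. F (\<beta> m)) = (\<Sum>J<M. \<Sum>m\<in>{m \<in> {..<N}. \<beta> m = J}. F (\<beta> m))"
    using \<beta> by (intro sum.group[symmetric]) auto
  also have "\<dots> = (\<Sum>J<M. real (card {m \<in> {..<N}. \<beta> m = J}) *\<^sub>R F J)"
    by (intro sum.cong refl) (simp add: sum_constant_scaleR)
  finally show ?thesis
    unfolding block_freq_def eq by (simp add: \<beta>_def scaleR_sum_right divide_inverse mult.commute)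
qed

text \<open>
  Each of the M intervals has asymptotic frequency at most 1/M. As the frequencies add up to 1, none
  can be smaller either.
\<close>

lemma weyl_imp_block_freq:
  assumes "weyl_criterion y" "J < M"
  shows "block_freq y M J \<longlonglongrightarrow> 1 / real M"
proof -
  have "M > 0" using assms by simp
  have upper: "\<forall>\<^sub>F N in sequentially. block_freq y M J N < 1 / real M + e" if "e > 0" for J e
  proof -
    \<comment> \<open>The J-th interval is the arc of radius 1 / (2 M) around its midpoint c.\<close>
    define c where "c = (real J + 1 / 2) / real M"
    have sub: "{m. m < N \<and> \<lfloor>real M * y m\<rfloor> mod int M = int J}
        \<subseteq> {m. m < N \<and> (\<exists>n::int. \<bar>y m - c - of_int n\<bar> \<le> 1 / (2 * real M))}" for N
    proof clarify
      fix m assume J: "\<lfloor>real M * y m\<rfloor> mod int M = int J"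
      define n where "n = \<lfloor>real M * y m\<rfloor> div int M"
      have "\<lfloor>real M * y m\<rfloor> = int M * n + int J"
        unfolding n_def J[symmetric] by simp
      then have "\<bar>real M * y m - real J - 1 / 2 - real M * of_int n\<bar> \<le> 1 / 2"
        using floor_correct[of "real M * y m"] by (simp only: of_int_add of_int_mult of_int_of_nat_eq) linarith
      moreover have "real M * y m - real J - 1 / 2 - real M * of_int n = real M * (y m - c - of_int n)"
        using \<open>M > 0\<close> by (simp add: c_def field_simps)
      ultimately have "real M * \<bar>y m - c - of_int n\<bar> \<le> 1 / 2"
        by (simp add: abs_mult)
      then have "\<bar>y m - c - of_int n\<bar> \<le> 1 / (2 * real M)"
        using \<open>M > 0\<close> by (simp add: field_simps)
      then show "\<exists>n::int. \<bar>y m - c - of_int n\<bar> \<le> 1 / (2 * real M)" ..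
    qed
    have le: "block_freq y M J N
        \<le> real (card {m. m < N \<and> (\<exists>n::int. \<bar>y m - c - of_int n\<bar> \<le> 1 / (2 * real M))}) / real N" for N
      unfolding block_freq_def by (intro divide_right_mono of_nat_mono card_mono sub) auto
    have "2 * (1 / (2 * real M)) + e = 1 / real M + e" by simp
    with weyl_arc_upper_bound[OF assms(1), of "1 / (2 * real M)" e c] that
    show ?thesis
      by (auto elim!: eventually_mono intro: le_less_trans[OF le])
  qed
  have total: "(\<Sum>J<M. block_freq y M J N) = 1" if "N > 0" for N
    using sum_by_blocks[OF \<open>M > 0\<close>, where F = "\<lambda>_. 1 :: real" and y = y and N = N] that by simp
  show ?thesis unfolding tendsto_iff
  proof (intro allI impI)
    fix e :: real assume "e > 0"
    then have "e / real M > 0" using \<open>M > 0\<close> by simp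
    then have "\<forall>\<^sub>F N in sequentially. \<forall>J'\<in>{..<M}. block_freq y M J' N < 1 / real M + e / real M"
      by (intro eventually_ball_finite ballI upper) auto
    then show "\<forall>\<^sub>F N in sequentially. dist (block_freq y M J N) (1 / real M) < e"
      using eventually_gt_at_top[of 0]
    proof eventually_elim
      case (elim N)
      have "e / real M \<le> e" using \<open>M > 0\<close> \<open>e > 0\<close> by (simp add: field_simps)
      have "1 - block_freq y M J N = (\<Sum>J'\<in>{..<M} - {J}. block_freq y M J' N)"
        using total[OF elim(2)] assms(2) by (simp add: sum_diff1)
      also have "\<dots> \<le> (\<Sum>J'\<in>{..<M} - {J}. 1 / real M + e / real M)"
        using elim(1) by (intro sum_mono) (auto intro: less_imp_le)
      also have "\<dots> = 1 + e - (1 / real M + e / real M)"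
        using assms(2) \<open>M > 0\<close> by (simp add: of_nat_diff field_simps)
      finally have "1 / real M - block_freq y M J N < e"
        using \<open>e / real M > 0\<close> by linarith
      moreover have "block_freq y M J N < 1 / real M + e / real M"
        using elim(1) assms(2) by blast
      ultimately show ?case using \<open>e / real M \<le> e\<close> by (simp add: dist_real_def abs_less_iff)
    qed
  qed
qed

text \<open>
  Replacing y by the left end point of its interval changes e(k y) by at most 2 \<pi> |k| / M, and
  turns the average of e(k y) into a combination of block frequencies that converges to the sum of
  e(k J / M) over J < M, divided by M. That sum vanishes once M > |k|.
\<close>

lemma weyl_if_block_freq:
  assumes "\<And>B. \<exists>M>B. \<forall>J<M. block_freq y M J \<longlonglongrightarrow> 1 / real M"
  shows "weyl_criterion y"
  unfolding weyl_criterion_def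
proof (intro allI impI mean_zero_approx)
  fix k :: int and e :: real assume "k \<noteq> 0" "e > 0"
  obtain M where M: "M > nat \<lceil>max \<bar>of_int k\<bar> (2 * pi * \<bar>of_int k\<bar> / e)\<rceil>"
    "\<forall>J<M. block_freq y M J \<longlonglongrightarrow> 1 / real M"
    using assms by blast
  then have "M > 0" "real M > \<bar>of_int k\<bar>" "real M > 2 * pi * \<bar>of_int k\<bar> / e"
    by linarith+
  define F where "F = (\<lambda>J. circle_char (of_int k * (real J / real M)))"
  define v where "v = (\<lambda>m. F (nat (\<lfloor>real M * y m\<rfloor> mod int M)))"
  have "(\<lambda>N. (\<Sum>J<M. block_freq y M J N *\<^sub>R F J)) \<longlonglongrightarrow> (\<Sum>J<M. (1 / real M) *\<^sub>R F J)"
    using M(2) by (intro tendsto_sum tendsto_scaleR tendsto_const) auto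
  moreover have "(\<Sum>J<M. (1 / real M) *\<^sub>R F J) = 0"
  proof -
    have "\<not> int M dvd k" using \<open>real M > \<bar>of_int k\<bar>\<close> \<open>k \<noteq> 0\<close> zdvd_not_zless[of "\<bar>k\<bar>" "int M"] by auto
    then show ?thesis
      using sum_roots_of_unity[OF \<open>M > 0\<close>] by (simp add: F_def flip: scaleR_sum_right)
  qed
  moreover have "(\<Sum>m<N. v m) / of_nat N = (\<Sum>J<M. block_freq y M J N *\<^sub>R F J)" for N
    unfolding sum_by_blocks[OF \<open>M > 0\<close>, symmetric] v_def
    by (simp add: scaleR_conv_of_real divide_inverse mult.commute)
  ultimately have "mean_zero v" by (simp only: mean_zero_def)
  moreover have "norm (circle_char (of_int k * y m) - v m) \<le> e" for m
  proof -
    define a where "a = \<lfloor>real M * y m\<rfloor>"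
    have a: "of_int (a mod int M) = of_int a - real M * of_int (a div int M)"
      by (metis minus_mult_div_eq_mod of_int_diff of_int_mult of_int_of_nat_eq)
    have "of_int k * (of_int (a mod int M) / real M)
        = of_int k * (of_int a / real M) + of_int (- k * (a div int M))"
      unfolding a using \<open>M > 0\<close> by (simp add: field_simps)
    then have "v m = circle_char (of_int k * (of_int a / real M))"
      using \<open>M > 0\<close> by (simp add: v_def F_def a_def[symmetric] circle_char_add_int del: of_int_mult of_int_minus)
    then have "norm (circle_char (of_int k * y m) - v m)
        \<le> 2 * pi * \<bar>of_int k * y m - of_int k * (of_int a / real M)\<bar>"
      by (simp only: circle_char_lipschitz)
    also have "\<dots> = 2 * pi * \<bar>of_int k\<bar> * \<bar>y m - of_int a / real M\<bar>"
      by (simp only: abs_mult right_diff_distrib[symmetric] mult.assoc)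
    also have "\<dots> \<le> 2 * pi * \<bar>of_int k\<bar> * (1 / real M)"
    proof (intro mult_left_mono)
      have "\<bar>real M * y m - of_int a\<bar> \<le> 1" unfolding a_def by linarith
      then show "\<bar>y m - of_int a / real M\<bar> \<le> 1 / real M"
        using \<open>M > 0\<close> by (simp add: field_simps abs_le_iff)
    qed auto
    also have "\<dots> \<le> e"
      using \<open>real M > 2 * pi * \<bar>of_int k\<bar> / e\<close> \<open>M > 0\<close> \<open>e > 0\<close> by (simp add: field_simps)
    finally show ?thesis .
  qed
  ultimately show "\<exists>v. mean_zero v \<and> (\<forall>m. norm (circle_char (of_int k * y m) - v m) \<le> e)" by blast
qed

section \<open>Normality to an integer base\<close>

definition word_value :: "nat \<Rightarrow> nat list \<Rightarrow> nat" where
  "word_value D w = foldl (\<lambda>a d. D * a + d) 0 w"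

lemma word_value_snoc: "word_value D (w @ [d]) = D * word_value D w + d"
  by (simp add: word_value_def)

lemma word_value_less:
  assumes "set w \<subseteq> {0..<D}"
  shows "word_value D w < D ^ length w"
  using assms
proof (induction w rule: rev_induct)
  case (snoc d w)
  then have "D * Suc (word_value D w) \<le> D * D ^ length w" by (intro mult_left_mono) auto
  moreover have "d < D" using snoc by simp
  ultimately show ?case unfolding word_value_snoc by simp
qed (simp add: word_value_def)

text \<open>
  With the bound \<open>word_value_less\<close> this makes words of length L correspond to the intervals of length
  D^(-L), so normality for all words is equidistribution over all D-adic intervals.
\<close>

lemma word_value_surj:
  assumes "J < D ^ L"
  shows "\<exists>w. length w = L \<and> set w \<subseteq> {0..<D} \<and> word_value D w = J"
  using assms
proof (induction L arbitrary: J)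
  case 0
  then show ?case by (simp add: word_value_def)
next
  case (Suc L)
  then have "D > 0" by (cases "D = 0") auto
  have "J div D < D ^ L" using Suc.prems by (simp add: less_mult_imp_div_less mult.commute)
  then obtain w where "length w = L" "set w \<subseteq> {0..<D}" "word_value D w = J div D"
    using Suc.IH by blast
  then show ?case using \<open>D > 0\<close>
    by (intro exI[of _ "w @ [J mod D]"]) (simp add: word_value_snoc)
qed

text \<open>
  Appending one digit to the word multiplies the value by D and adds the digit. On the other side,
  the floor of D^(L+1) D^m x has the floor of D^L D^m x as its quotient by D, and the new digit as its
  remainder.
\<close>

lemma digits_eq_word_iff:
  assumes "D > 0" "set w \<subseteq> {0..<D}"
  shows "(\<forall>j<length w. base_digit D x (m + j) = w ! j) \<longleftrightarrow>
    \<lfloor>real (D ^ length w) * (real D ^ m * x)\<rfloor> mod int (D ^ length w) = int (word_value D w)"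
  using assms(2)
proof (induction w rule: rev_induct)
  case Nil
  then show ?case by (simp add: word_value_def)
next
  case (snoc d w)
  define L where "L = length w"
  define a b where "a = \<lfloor>real (D ^ L) * (real D ^ m * x)\<rfloor>" and "b = \<lfloor>real (D ^ Suc L) * (real D ^ m * x)\<rfloor>"
  have d: "d < D" using snoc.prems by simp
  have "a = b div int D"
    using floor_divide_real_eq_div[of "int D" "real (D ^ Suc L) * (real D ^ m * x)"] \<open>D > 0\<close>
    by (simp add: a_def b_def)
  then have b: "b mod int (D ^ Suc L) = int D * (a mod int (D ^ L)) + b mod int D"
    by (simp add: zmod_zmult2_eq)
  have digit: "base_digit D x (m + L) = d \<longleftrightarrow> b mod int D = int d"
  proof -
    have "base_digit D x (m + L) = nat (b mod int D)"
      by (simp add: base_digit_def b_def power_add mult_ac)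
    then show ?thesis using \<open>D > 0\<close> by auto
  qed
  have "(\<forall>j<length (w @ [d]). base_digit D x (m + j) = (w @ [d]) ! j) \<longleftrightarrow>
      (\<forall>j<L. base_digit D x (m + j) = w ! j) \<and> base_digit D x (m + L) = d"
    by (auto simp: L_def nth_append less_Suc_eq)
  also have "\<dots> \<longleftrightarrow> a mod int (D ^ L) = int (word_value D w) \<and> b mod int D = int d"
    using snoc by (simp add: digit[unfolded L_def] a_def L_def)
  also have "\<dots> \<longleftrightarrow> int D * (a mod int (D ^ L)) + b mod int D = int D * int (word_value D w) + int d"
  proof
    assume eq: "int D * (a mod int (D ^ L)) + b mod int D = int D * int (word_value D w) + int d"
    have r: "0 \<le> b mod int D" "b mod int D < int D" using \<open>D > 0\<close> by auto
    from arg_cong[OF eq, of "\<lambda>z. z mod int D"] arg_cong[OF eq, of "\<lambda>z. z div int D"] r d \<open>D > 0\<close>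
    show "a mod int (D ^ L) = int (word_value D w) \<and> b mod int D = int d"
      by (simp add: div_add1_eq)
  qed simp
  also have "\<dots> \<longleftrightarrow> b mod int (D ^ Suc L) = int (word_value D (w @ [d]))"
    unfolding b word_value_snoc by simp
  finally show ?case by (simp add: b_def L_def)
qed

lemma normal_to_base_iff_weyl_criterion:
  assumes "D \<ge> 2"
  shows "normal_to_base D x \<longleftrightarrow> weyl_criterion (\<lambda>m. real D ^ m * x)"
proof -
  have freq: "real (card {m. m < N \<and> (\<forall>j<length w. base_digit D x (m + j) = w ! j)}) / real N
      = block_freq (\<lambda>m. real D ^ m * x) (D ^ length w) (word_value D w) N"
    if "set w \<subseteq> {0..<D}" for w N
    using digits_eq_word_iff[of D w x] that assms by (simp add: block_freq_def)
  show ?thesis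
  proof
    assume normal: "normal_to_base D x"
    show "weyl_criterion (\<lambda>m. real D ^ m * x)"
    proof (rule weyl_if_block_freq)
      fix B
      have "block_freq (\<lambda>m. real D ^ m * x) (D ^ B) J \<longlonglongrightarrow> 1 / real (D ^ B)" if J: "J < D ^ B" for J
      proof -
        obtain w where "length w = B" "set w \<subseteq> {0..<D}" "word_value D w = J"
          using word_value_surj[OF J] by blast
        with normal show ?thesis by (auto simp: normal_to_base_def freq)
      qed
      moreover have "D ^ B > B" using assms by (intro power_gt_expt) auto
      ultimately show "\<exists>M>B. \<forall>J<M. block_freq (\<lambda>m. real D ^ m * x) M J \<longlonglongrightarrow> 1 / real M"
        by blast
    qed
  next
    assume "weyl_criterion (\<lambda>m. real D ^ m * x)"
    from weyl_imp_block_freq[OF this word_value_less]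
    show "normal_to_base D x" by (simp add: normal_to_base_def freq)
  qed
qed

text \<open>
  By the pigeonhole principle two powers of D agree modulo Q. The factor D^s accounts for the primes
  that D shares with Q, for which no power of D is 1 modulo Q.
\<close>

lemma dvd_power_times_power_minus_one:
  fixes D :: int
  assumes "Q > 0"
  obtains s p where "p > 0" "int Q dvd D ^ s * (D ^ p - 1)"
proof -
  have "range (\<lambda>i. D ^ i mod int Q) \<subseteq> {0..<int Q}" using assms by auto
  then have "finite (range (\<lambda>i. D ^ i mod int Q))" by (rule finite_subset) simp
  then have "\<not> inj (\<lambda>i::nat. D ^ i mod int Q)" using finite_imageD by blast
  then obtain i j :: nat where "i \<noteq> j" "D ^ i mod int Q = D ^ j mod int Q"
    by (auto simp: inj_def)
  then obtain i j :: nat where ij: "i < j" "D ^ i mod int Q = D ^ j mod int Q"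
    by (metis linorder_neqE_nat)
  then have "int Q dvd D ^ j - D ^ i" by (metis mod_eq_dvd_iff)
  also have "D ^ j - D ^ i = D ^ i * (D ^ (j - i) - 1)"
    using ij(1) by (simp add: right_diff_distrib flip: power_add)
  finally show ?thesis using that[of "j - i" i] ij(1) by simp
qed

text \<open>
  Wall's theorem that a number with a normal integer multiple is normal. The correlation of
  e(k D^m x) at distance p h is e(k (D^(p h) - 1) D^m x). For suitable s and p the factor
  D^s (D^(p h) - 1) is a multiple of Q, so after shifting the index by s the correlation is a
  character sequence of Q x.
\<close>

lemma weyl_divide:
  assumes "D \<ge> 2" "Q > 0" "weyl_criterion (\<lambda>m. real D ^ m * (real Q * x))"
  shows "weyl_criterion (\<lambda>m. real D ^ m * x)"
  unfolding weyl_criterion_def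
proof (intro allI impI)
  fix k :: int assume "k \<noteq> 0"
  obtain s p where p: "p > 0" "int Q dvd int D ^ s * (int D ^ p - 1)"
    using dvd_power_times_power_minus_one[OF assms(2)] .
  define u where "u = (\<lambda>m. circle_char (of_int k * (real D ^ m * x)))"
  have "mean_zero u"
  proof (rule van_der_Corput[where p = p])
    fix h :: nat assume "h \<ge> 1"
    have "int D ^ p - 1 dvd int D ^ (p * h) - 1"
      unfolding power_mult by (metis dvd_triv_left power_diff_1_eq)
    then have "int Q dvd int D ^ s * (int D ^ (p * h) - 1)"
      using p(2) by (meson dvd_trans mult_dvd_mono dvd_refl)
    then obtain c where c: "int D ^ s * (int D ^ (p * h) - 1) = int Q * c" ..
    have "1 < int D ^ (p * h)" using assms(1) p(1) \<open>h \<ge> 1\<close> by (intro one_less_power) auto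
    then have "c \<noteq> 0" using c assms by auto
    have "u (m + s + p * h) * cnj (u (m + s)) = circle_char (of_int (k * c) * (real D ^ m * (real Q * x)))" for m
    proof -
      have c': "real D ^ s * (real D ^ (p * h) - 1) = real Q * of_int c"
        using arg_cong[OF c, of real_of_int] by simp
      have "of_int k * (real D ^ (m + s + p * h) * x) - of_int k * (real D ^ (m + s) * x)
          = of_int k * real D ^ m * x * (real D ^ s * (real D ^ (p * h) - 1))"
        by (simp add: power_add algebra_simps)
      also have "\<dots> = of_int (k * c) * (real D ^ m * (real Q * x))"
        unfolding c' by simp
      finally show ?thesis by (simp only: u_def flip: circle_char_diff)
    qed
    moreover have "mean_zero (\<lambda>m. circle_char (of_int (k * c) * (real D ^ m * (real Q * x))))"
      using assms(3)[unfolded weyl_criterion_def, rule_format, of "k * c"] \<open>k \<noteq> 0\<close> \<open>c \<noteq> 0\<close> by simp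
    ultimately show "mean_zero (\<lambda>m. u (m + p * h) * cnj (u m))"
      by (subst mean_zero_shift_iff[of _ s, symmetric]) simp
  qed (simp add: u_def)
  then show "mean_zero (\<lambda>m. circle_char (of_int k * (real D ^ m * x)))" by (simp add: u_def)
qed

section \<open>A law of large numbers for weakly correlated variables\<close>

lemma filterlim_floor_sqrt: "filterlim floor_sqrt at_top at_top"
  unfolding filterlim_at_top
proof
  fix Z
  show "\<forall>\<^sub>F N in sequentially. Z \<le> floor_sqrt N"
    using eventually_ge_at_top[of "Z\<^sup>2"] by eventually_elim (simp add: le_floor_sqrt_iff)
qed

text \<open>
  Between consecutive squares n^2 and (n+1)^2 there are at most 2 n further bounded terms, which is
  negligible against n^2.
\<close>

lemma mean_zero_if_squares:
  assumes bound: "\<And>m. norm (u m) \<le> B"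
    and squares: "(\<lambda>n. norm (\<Sum>m<n\<^sup>2. u m) / real (n\<^sup>2)) \<longlonglongrightarrow> 0"
  shows "mean_zero u"
proof -
  define r where "r = (\<lambda>n. norm (\<Sum>m<n\<^sup>2. u m) / real (n\<^sup>2) + 2 * B / real n)"
  have "B \<ge> 0" using bound[of 0] norm_ge_zero order_trans by blast
  have "r \<longlonglongrightarrow> 0 + 0"
    unfolding r_def by (intro tendsto_add squares lim_const_over_n)
  then have "(\<lambda>N. r (floor_sqrt N)) \<longlonglongrightarrow> 0"
    using filterlim_compose[OF _ filterlim_floor_sqrt] by simp
  moreover have "\<forall>\<^sub>F N in sequentially. norm ((\<Sum>m<N. u m) / of_nat N) \<le> r (floor_sqrt N)"
    using eventually_gt_at_top[of 0]
  proof eventually_elim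
    case (elim N)
    define n where "n = floor_sqrt N"
    have n: "n > 0" "n\<^sup>2 \<le> N" "N \<le> n\<^sup>2 + 2 * n"
      using elim Suc_floor_sqrt_power2_gt[of N] floor_sqrt_power2_le[of N, unfolded power2_eq_square]
      by (auto simp: n_def power2_eq_square)
    have "(\<Sum>m<N. u m) = (\<Sum>m<n\<^sup>2. u m) + (\<Sum>m\<in>{n\<^sup>2..<N}. u m)"
      using n(2) by (metis atLeast0LessThan sum.atLeastLessThan_concat zero_le)
    also have "norm \<dots> \<le> norm (\<Sum>m<n\<^sup>2. u m) + norm (\<Sum>m\<in>{n\<^sup>2..<N}. u m)"
      by (rule norm_triangle_ineq)
    also have "norm (\<Sum>m\<in>{n\<^sup>2..<N}. u m) \<le> (\<Sum>m\<in>{n\<^sup>2..<N}. B)"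
      by (intro sum_norm_le bound)
    also have "\<dots> = real (N - n\<^sup>2) * B" by simp
    also have "real (N - n\<^sup>2) * B \<le> real (2 * n) * B"
      using n \<open>B \<ge> 0\<close> by (intro mult_right_mono of_nat_mono) auto
    finally have "norm (\<Sum>m<N. u m) \<le> norm (\<Sum>m<n\<^sup>2. u m) + 2 * real n * B" by simp
    then have "norm ((\<Sum>m<N. u m) / of_nat N) \<le> (norm (\<Sum>m<n\<^sup>2. u m) + 2 * real n * B) / real N"
      by (simp add: norm_divide divide_right_mono)
    also have "\<dots> \<le> (norm (\<Sum>m<n\<^sup>2. u m) + 2 * real n * B) / real (n\<^sup>2)"
      using n elim \<open>B \<ge> 0\<close> by (intro divide_left_mono of_nat_mono mult_pos_pos) auto
    also have "\<dots> = r n"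
      using n(1) by (simp add: r_def add_divide_distrib power2_eq_square)
    finally show ?case by (simp add: n_def)
  qed
  ultimately show ?thesis
    unfolding mean_zero_def by (rule Lim_null_comparison[rotated])
qed

lemma borel_measurable_cnj [measurable]:
  assumes "f \<in> borel_measurable M"
  shows "(\<lambda>x. cnj (f x)) \<in> borel_measurable M"
  by (rule measurable_compose[OF assms borel_measurable_continuous_onI]) (intro continuous_intros)

lemma (in prob_space) norm_integral_le_const:
  fixes f :: "'a \<Rightarrow> 'b::{banach, second_countable_topology}"
  assumes "f \<in> borel_measurable M" "\<And>x. x \<in> space M \<Longrightarrow> norm (f x) \<le> c"
  shows "norm (\<integral>x. f x \<partial>M) \<le> c"
proof -
  have "integrable M f" using assms by (intro integrable_const_bound[of _ c]) auto
  then have "norm (\<integral>x. f x \<partial>M) \<le> (\<integral>x. norm (f x) \<partial>M)" by (intro integral_norm_bound)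
  also have "\<dots> \<le> c"
    using \<open>integrable M f\<close> assms by (intro integral_le_const) auto
  finally show ?thesis .
qed

text \<open>
  The second moments of the averages over m < n^2 are O(1/n^2), hence summable. So almost surely the
  squares of these averages are summable and tend to 0. The remaining indices are filled in by
  boundedness.
\<close>

lemma (in prob_space) AE_mean_zero_if_variance:
  fixes X :: "nat \<Rightarrow> 'a \<Rightarrow> complex"
  assumes [measurable]: "\<And>m. X m \<in> borel_measurable M"
    and bound: "\<And>m x. x \<in> space M \<Longrightarrow> norm (X m x) \<le> B"
    and variance: "\<And>N. expectation (\<lambda>x. (norm (\<Sum>m<N. X m x))\<^sup>2) \<le> C * real N"
  shows "AE x in M. mean_zero (\<lambda>m. X m x)"
proof -
  define V where "V = (\<lambda>N x. (norm (\<Sum>m<N. X m x))\<^sup>2)"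
  have V_measurable [measurable]: "V N \<in> borel_measurable M" for N
    unfolding V_def by measurable
  have V_integrable: "integrable M (V N)" for N
  proof (rule integrable_const_bound[of _ "(real N * B)\<^sup>2"])
    show "AE x in M. norm (V N x) \<le> (real N * B)\<^sup>2"
    proof (rule AE_I2)
      fix x assume "x \<in> space M"
      then have "norm (\<Sum>m<N. X m x) \<le> (\<Sum>m<N. B)" by (intro sum_norm_le bound)
      then show "norm (V N x) \<le> (real N * B)\<^sup>2" by (simp add: V_def power_mono)
    qed
  qed simp
  define a where "a = (\<lambda>n x. V (n\<^sup>2) x / (real (n\<^sup>2))\<^sup>2)"
  have "(\<integral>\<^sup>+ x. (\<Sum>n. ennreal (a n x)) \<partial>M) = (\<Sum>n. \<integral>\<^sup>+ x. ennreal (a n x) \<partial>M)"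
    unfolding a_def by (intro nn_integral_suminf) measurable
  \<comment> \<open>The term n = 0 is 0 on both sides, by the conventions x / 0 = 0 and inverse 0 = 0.\<close>
  also have "\<dots> \<le> (\<Sum>n. ennreal (\<bar>C\<bar> * inverse (real n ^ 2)))"
  proof (intro suminf_le summableI)
    fix n
    have "(\<integral>\<^sup>+ x. ennreal (a n x) \<partial>M) = ennreal (expectation (a n))"
      using V_integrable by (intro nn_integral_eq_integral) (auto simp: a_def V_def)
    also have "expectation (a n) = expectation (V (n\<^sup>2)) / (real (n\<^sup>2))\<^sup>2"
      by (simp add: a_def)
    also have "\<dots> \<le> (\<bar>C\<bar> * real (n\<^sup>2)) / (real (n\<^sup>2))\<^sup>2"
      using variance[of "n\<^sup>2"] mult_right_mono[OF abs_ge_self[of C], of "real (n\<^sup>2)"]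
      by (intro divide_right_mono) (auto simp: V_def)
    also have "\<dots> = \<bar>C\<bar> * inverse (real n ^ 2)"
      by (cases "n = 0") (simp_all add: power2_eq_square field_simps)
    finally show "(\<integral>\<^sup>+ x. ennreal (a n x) \<partial>M) \<le> ennreal (\<bar>C\<bar> * inverse (real n ^ 2))"
      by (simp add: ennreal_leI)
  qed
  also have "\<dots> < \<infinity>"
  proof -
    have "summable (\<lambda>n. \<bar>C\<bar> * inverse (real n ^ 2))"
      using inverse_power_summable[of 2, where 'a = real] by (intro summable_mult) auto
    then have "(\<Sum>n. ennreal (\<bar>C\<bar> * inverse (real n ^ 2))) = ennreal (\<Sum>n. \<bar>C\<bar> * inverse (real n ^ 2))"
      by (intro suminf_ennreal2) auto
    then show ?thesis by simp
  qed
  finally have "AE x in M. (\<Sum>n. ennreal (a n x)) \<noteq> \<infinity>"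
    by (intro nn_integral_PInf_AE) (auto simp: a_def)
  then show ?thesis
  proof (rule AE_mp, intro AE_I2 impI)
    fix x assume "x \<in> space M" "(\<Sum>n. ennreal (a n x)) \<noteq> \<infinity>"
    then have "summable (\<lambda>n. a n x)"
      by (intro summable_suminf_not_top) (auto simp: a_def V_def)
    then have "(\<lambda>n. a n x) \<longlonglongrightarrow> 0" by (rule summable_LIMSEQ_zero)
    then have "(\<lambda>n. sqrt (a n x)) \<longlonglongrightarrow> sqrt 0" by (rule tendsto_real_sqrt)
    moreover have "sqrt (a n x) = norm (\<Sum>m<n\<^sup>2. X m x) / real (n\<^sup>2)" for n
      by (simp add: a_def V_def real_sqrt_divide del: of_nat_power)
    ultimately have "(\<lambda>n. norm (\<Sum>m<n\<^sup>2. X m x) / real (n\<^sup>2)) \<longlonglongrightarrow> 0"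
      by simp
    then show "mean_zero (\<lambda>m. X m x)"
      using bound[OF \<open>x \<in> space M\<close>] by (intro mean_zero_if_squares)
  qed
qed

text \<open>
  The exponent is the distance of m and n. Each of the two sides n < m and n \<ge> m contributes at most
  a full geometric series.
\<close>

lemma sum_power_distance_le:
  fixes r :: real
  assumes "0 \<le> r" "r < 1"
  shows "(\<Sum>n<N. r ^ (max m n - min m n)) \<le> 2 / (1 - r)"
proof -
  have geo: "(\<Sum>i\<in>I. r ^ i) \<le> 1 / (1 - r)" if "finite I" for I
    using that assms sum_le_suminf[OF summable_geometric, of r I] by (simp add: suminf_geometric)
  have "(\<Sum>n<N. r ^ (max m n - min m n)) \<le> (\<Sum>n<N. (if n < m then r ^ (m - n) else 0) + (if n < m then 0 else r ^ (n - m)))"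
    by (intro sum_mono) (auto simp: max_def min_def)
  also have "\<dots> = (\<Sum>n\<in>{..<N} \<inter> {..<m}. r ^ (m - n)) + (\<Sum>n\<in>{..<N} - {..<m}. r ^ (n - m))"
    by (simp add: sum.distrib sum.If_cases lessThan_def Collect_conj_eq[symmetric] Int_def set_diff_eq)
  also have "(\<Sum>n\<in>{..<N} \<inter> {..<m}. r ^ (m - n)) = (\<Sum>i\<in>(\<lambda>n. m - n) ` ({..<N} \<inter> {..<m}). r ^ i)"
    by (subst sum.reindex) (auto simp: inj_on_def)
  also have "(\<Sum>n\<in>{..<N} - {..<m}. r ^ (n - m)) = (\<Sum>i\<in>(\<lambda>n. n - m) ` ({..<N} - {..<m}). r ^ i)"
    by (subst sum.reindex) (auto simp: inj_on_def)
  also have "(\<Sum>i\<in>(\<lambda>n. m - n) ` ({..<N} \<inter> {..<m}). r ^ i) + \<dots> \<le> 1 / (1 - r) + 1 / (1 - r)"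
    by (intro add_mono geo) auto
  finally show ?thesis by simp
qed

text \<open>
  Expanding the square, the second moment of the sum over m < N is a double sum of correlations; each
  of its N rows is bounded by a geometric series, so it is at most a constant times N.
\<close>

lemma (in prob_space) AE_mean_zero_if_correlations_decay:
  fixes X :: "nat \<Rightarrow> 'a \<Rightarrow> complex" and r :: real
  assumes [measurable]: "\<And>m. X m \<in> borel_measurable M"
    and bound: "\<And>m x. x \<in> space M \<Longrightarrow> norm (X m x) \<le> B"
    and r: "0 \<le> r" "r < 1" and "C \<ge> 0"
    and decay: "\<And>m n. m \<le> n \<Longrightarrow> norm (expectation (\<lambda>x. X m x * cnj (X n x))) \<le> C * r ^ (n - m)"
  shows "AE x in M. mean_zero (\<lambda>m. X m x)"
proof (rule AE_mean_zero_if_variance[OF _ bound, where C = "C * (2 / (1 - r))"])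
  fix N
  have int: "integrable M (\<lambda>x. X m x * cnj (X n x))" for m n
  proof (rule integrable_const_bound[of _ "B * B"])
    show "AE x in M. norm (X m x * cnj (X n x)) \<le> B * B"
    proof (rule AE_I2)
      fix x assume "x \<in> space M"
      then show "norm (X m x * cnj (X n x)) \<le> B * B"
        using bound[of x m] bound[of x n] order_trans[OF norm_ge_zero bound[of x m]]
        by (simp add: norm_mult mult_mono)
    qed
  qed simp
  have sym: "norm (expectation (\<lambda>x. X m x * cnj (X n x))) \<le> C * r ^ (max m n - min m n)" for m n
  proof (cases "m \<le> n")
    case False
    have "expectation (\<lambda>x. X m x * cnj (X n x)) = expectation (\<lambda>x. cnj (X n x * cnj (X m x)))"
      by (simp add: mult.commute)
    also have "\<dots> = cnj (expectation (\<lambda>x. X n x * cnj (X m x)))" by (rule Bochner_Integration.integral_cnj)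
    finally show ?thesis using decay[of n m] False by simp
  qed (use decay in simp)
  have "of_real (expectation (\<lambda>x. (norm (\<Sum>m<N. X m x))\<^sup>2))
      = expectation (\<lambda>x. complex_of_real ((norm (\<Sum>m<N. X m x))\<^sup>2))"
    by (rule integral_complex_of_real[symmetric])
  also have "\<dots> = expectation (\<lambda>x. \<Sum>m<N. \<Sum>n<N. X m x * cnj (X n x))"
    unfolding complex_norm_square by (simp add: sum_product)
  also have "\<dots> = (\<Sum>m<N. \<Sum>n<N. expectation (\<lambda>x. X m x * cnj (X n x)))"
    using int by (simp add: Bochner_Integration.integral_sum)
  finally have "norm (of_real (expectation (\<lambda>x. (norm (\<Sum>m<N. X m x))\<^sup>2)) :: complex)
      \<le> (\<Sum>m<N. \<Sum>n<N. C * r ^ (max m n - min m n))"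
    by (simp only:) (intro sum_norm_le sym)
  also have "\<dots> = (\<Sum>m<N. C * (\<Sum>n<N. r ^ (max m n - min m n)))"
    by (simp only: sum_distrib_left)
  also have "\<dots> \<le> (\<Sum>m<N. C * (2 / (1 - r)))"
    using r \<open>C \<ge> 0\<close> by (intro sum_mono mult_left_mono sum_power_distance_le)
  finally show "expectation (\<lambda>x. (norm (\<Sum>m<N. X m x))\<^sup>2) \<le> C * (2 / (1 - r)) * real N"
    unfolding norm_of_real by (simp add: mult_ac)
qed simp

text \<open>
  The tolerances in the definition of the limit can be restricted to 1/(j+1), which leaves countably
  many quantifiers.
\<close>

lemma mean_zero_measurable:
  assumes [measurable]: "\<And>m. u m \<in> borel_measurable M"
  shows "Measurable.pred M (\<lambda>x. mean_zero (\<lambda>m. u m x))"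
proof -
  have "mean_zero v \<longleftrightarrow> (\<forall>j. \<exists>N0. \<forall>N\<ge>N0. norm ((\<Sum>m<N. v m) / of_nat N) < inverse (real (Suc j)))" for v
    unfolding mean_zero_def LIMSEQ_iff
  proof (intro iffI allI impI)
    fix e :: real
    assume *: "\<forall>j. \<exists>N0. \<forall>N\<ge>N0. norm ((\<Sum>m<N. v m) / of_nat N) < inverse (real (Suc j))" and "e > 0"
    then obtain j where "inverse (real (Suc j)) < e" using reals_Archimedean by blast
    then show "\<exists>N0. \<forall>N\<ge>N0. norm ((\<Sum>m<N. v m) / of_nat N - 0) < e"
      using * by (metis diff_zero order.strict_trans)
  qed simp
  then show ?thesis by simp
qed

section \<open>Random series with independent digits\<close>

definition digit_series :: "real \<Rightarrow> (nat \<Rightarrow> real) \<Rightarrow> real" where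
  "digit_series D a = (\<Sum>n. a n / D ^ n)"

lemma sums_constant_digit:
  fixes D B :: real
  assumes D: "D \<ge> 2"
  shows "(\<lambda>n. B / D ^ n) sums (B * (D / (D - 1)))"
proof -
  have "(\<lambda>n. B * (1 / D) ^ n) sums (B * (1 / (1 - 1 / D)))"
    using D by (intro sums_mult geometric_sums) auto
  moreover have "1 / (1 - 1 / D) = D / (D - 1)" using D by (simp add: field_simps)
  ultimately show ?thesis by (simp add: power_one_over)
qed

context
  fixes D B :: real and a :: "nat \<Rightarrow> real"
  assumes D: "D \<ge> 2" and bound: "\<And>n. \<bar>a n\<bar> \<le> B"
begin

lemma norm_digit_le: "norm (a n / D ^ n) \<le> B / D ^ n"
  using D bound[of n] by (simp add: divide_right_mono)

lemma summable_digit_series: "summable (\<lambda>n. a n / D ^ n)"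
  by (rule summable_comparison_test'[OF sums_summable[OF sums_constant_digit[OF D]]])
     (rule norm_digit_le)

lemma digit_series_sums: "(\<lambda>n. a n / D ^ n) sums digit_series D a"
  unfolding digit_series_def by (rule summable_sums[OF summable_digit_series])

lemma abs_digit_series_le: "\<bar>digit_series D a\<bar> \<le> 2 * B"
proof -
  have "norm (digit_series D a) \<le> B * (D / (D - 1))"
    by (rule norm_sums_le[OF digit_series_sums sums_constant_digit[OF D] norm_digit_le])
  also have "\<dots> \<le> B * 2"
    using D order_trans[OF abs_ge_zero bound[of 0]] by (intro mult_left_mono) (auto simp: field_simps)
  finally show ?thesis by simp
qed

lemma digit_series_split:
  "digit_series D a = (\<Sum>j<l. a j / D ^ j) + digit_series D (\<lambda>n. a (n + l)) / D ^ l"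
proof -
  have "summable (\<lambda>n. a (n + l) / D ^ (n + l))"
    by (rule summable_ignore_initial_segment[OF summable_digit_series])
  then have "summable (\<lambda>n. (a (n + l) / D ^ (n + l)) * D ^ l)" by (rule summable_mult2)
  then have "summable (\<lambda>n. a (n + l) / D ^ n)" using D by (simp add: power_add)
  then have "(\<Sum>n. a (n + l) / D ^ n / D ^ l) = digit_series D (\<lambda>n. a (n + l)) / D ^ l"
    unfolding digit_series_def by (rule suminf_divide)
  then show ?thesis
    using suminf_split_initial_segment[OF summable_digit_series, of l]
    by (simp add: digit_series_def power_add)
qed

end

text \<open>
  Multiplication by D^m acts on series with integer digits as the shift by m, up to an integer, which
  the character does not see.
\<close>

lemma circle_char_power_times_digit_series:
  fixes D :: nat and a :: "nat \<Rightarrow> int" and k :: int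
  assumes "D \<ge> 2" "\<And>n. \<bar>real_of_int (a n)\<bar> \<le> B"
  shows "circle_char (of_int k * (real D ^ m * digit_series D a)) =
    circle_char (of_int k * digit_series D (\<lambda>n. a (n + m)))"
proof -
  have "real D ^ m * (\<Sum>j<m. a j / real D ^ j) = of_int (\<Sum>j<m. a j * int D ^ (m - j))"
  proof -
    have "real D ^ m * (a j / real D ^ j) = of_int (a j * int D ^ (m - j))" if "j < m" for j
    proof -
      have "real D ^ m = real D ^ (m - j) * real D ^ j"
        using that by (simp flip: power_add)
      then show ?thesis using assms(1) by simp
    qed
    then show ?thesis by (simp add: sum_distrib_left)
  qed
  moreover have "digit_series D a = (\<Sum>j<m. a j / real D ^ j) + digit_series D (\<lambda>n. a (n + m)) / real D ^ m"
    by (rule digit_series_split) (use assms in auto)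
  ultimately have "real D ^ m * digit_series D a
      = of_int (\<Sum>j<m. a j * int D ^ (m - j)) + digit_series D (\<lambda>n. a (n + m))"
    using assms(1) by (simp add: distrib_left)
  then have "of_int k * (real D ^ m * digit_series D a)
      = of_int k * digit_series D (\<lambda>n. a (n + m)) + of_int (k * (\<Sum>j<m. a j * int D ^ (m - j)))"
    by (simp add: distrib_left)
  then show ?thesis by (simp only: circle_char_add_int Ints_of_int)
qed

context sequence_space
begin

text \<open>
  The first n coordinates and the sequence of the remaining ones are independent, and the latter has
  the same law as the whole sequence.
\<close>

lemma integral_shift_decomposition:
  fixes G :: "(nat \<Rightarrow> 'a) \<Rightarrow> 'b::{banach, second_countable_topology}"
  assumes [measurable]: "G \<in> borel_measurable S"
    and bound: "\<And>\<omega>. \<omega> \<in> space S \<Longrightarrow> norm (G \<omega>) \<le> B"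
  shows "(\<integral>\<omega>. G \<omega> \<partial>S) = (\<integral>\<omega>. (\<integral>\<omega>'. G (comb_seq n \<omega> \<omega>') \<partial>S) \<partial>S)"
proof -
  interpret SS: pair_prob_space S S ..
  have "(\<integral>\<omega>. G \<omega> \<partial>S) = (\<integral>\<omega>. G \<omega> \<partial>distr (S \<Otimes>\<^sub>M S) S (\<lambda>(\<omega>, \<omega>'). comb_seq n \<omega> \<omega>'))"
    by (simp only: PiM_comb_seq)
  also have "\<dots> = (\<integral>z. G (case z of (\<omega>, \<omega>') \<Rightarrow> comb_seq n \<omega> \<omega>') \<partial>(S \<Otimes>\<^sub>M S))"
    by (intro integral_distr measurable_comb_seq assms)
  also have "\<dots> = (\<integral>(\<omega>, \<omega>'). G (comb_seq n \<omega> \<omega>') \<partial>(S \<Otimes>\<^sub>M S))"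
    by (simp add: case_prod_unfold)
  also have "\<dots> = (\<integral>\<omega>. (\<integral>\<omega>'. G (comb_seq n \<omega> \<omega>') \<partial>S) \<partial>S)"
  proof (rule SS.integral_fst[symmetric])
    show "integrable (S \<Otimes>\<^sub>M S) (\<lambda>(\<omega>, \<omega>'). G (comb_seq n \<omega> \<omega>'))"
    proof (rule SS.integrable_const_bound[of _ B])
      have "comb_seq n \<omega> \<omega>' \<in> space S" if "\<omega> \<in> space S" "\<omega>' \<in> space S" for \<omega> \<omega>'
        using that by (auto simp: space_PiM PiE_iff comb_seq_def)
      then show "AE z in S \<Otimes>\<^sub>M S. norm (case z of (\<omega>, \<omega>') \<Rightarrow> G (comb_seq n \<omega> \<omega>')) \<le> B"
        using bound by (intro AE_I2) (auto simp: space_pair_measure)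
    qed measurable
  qed
  finally show ?thesis .
qed

context
  fixes D :: nat and b :: "'a \<Rightarrow> real" and B :: real
  assumes D: "D \<ge> 2"
    and b_measurable [measurable]: "b \<in> borel_measurable M"
    and b_bound: "\<And>x. x \<in> space M \<Longrightarrow> \<bar>b x\<bar> \<le> B"
begin

lemma digit_series_measurable [measurable]:
  "(\<lambda>\<omega>. digit_series D (\<lambda>n. b (\<omega> (n + m)))) \<in> borel_measurable S"
  unfolding digit_series_def by measurable

text \<open>
  Let l = n - m. The series read from position m is a finite sum over the l coordinates before n, plus
  D^(-l) times the series read from position n. Dropping the second summand costs O(D^(-l)), uniformly.
  What is left depends on coordinates before n only, so it is independent of F n, whose fluctuation
  around \<phi> has mean 0.
\<close>

lemma shifted_character_correlations:
  fixes k :: int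
  defines "F \<equiv> (\<lambda>m \<omega>. circle_char (of_int k * digit_series D (\<lambda>n. b (\<omega> (n + m)))))"
  defines "\<phi> \<equiv> (\<integral>\<omega>. F 0 \<omega> \<partial>S)"
  assumes "m \<le> n"
  shows "norm (\<integral>\<omega>. (F m \<omega> - \<phi>) * cnj (F n \<omega> - \<phi>) \<partial>S)
    \<le> 8 * pi * \<bar>of_int k\<bar> * B * (1 / real D) ^ (n - m)"
proof -
  have [measurable]: "circle_char \<in> borel_measurable borel"
    unfolding circle_char_def cis_conv_exp by measurable
  have F_measurable [measurable]: "F m \<in> borel_measurable S" for m
    unfolding F_def by measurable
  have F_norm: "norm (F m \<omega>) = 1" for m \<omega> by (simp add: F_def)
  have \<phi>_norm: "norm \<phi> \<le> 1"
    unfolding \<phi>_def by (rule norm_integral_le_const) (auto simp: F_norm)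
  have diff_norm: "norm (F m \<omega> - \<phi>) \<le> 2" for m \<omega>
    using norm_triangle_ineq4[of "F m \<omega>" \<phi>] F_norm[of m \<omega>] \<phi>_norm by linarith
  define l where "l = n - m"
  have D_real: "real D \<ge> 2" using D by simp
  have b_seq: "\<bar>b (\<omega> i)\<bar> \<le> B" if "\<omega> \<in> space S" for \<omega> i
    using that by (intro b_bound) (auto simp: space_PiM)
  have B: "B \<ge> 0"
  proof -
    obtain x where "x \<in> space M" using M.not_empty by blast
    then show ?thesis using b_bound[of x] by linarith
  qed
  have inner: "norm (\<integral>\<omega>'. (F m (comb_seq n \<omega> \<omega>') - \<phi>) * cnj (F n (comb_seq n \<omega> \<omega>') - \<phi>) \<partial>S)
      \<le> 8 * pi * \<bar>of_int k\<bar> * B * (1 / real D) ^ l" (is "norm (integral\<^sup>L S ?H) \<le> ?K")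
    if \<omega>: "\<omega> \<in> space S" for \<omega>
  proof -
    \<comment> \<open>For a fixed past \<omega>, the value F m factors into the constant A and the nearly constant E; replacing E by 1 gives the main term (A - \<phi>) * cnj (F 0 - \<phi>), which integrates to 0.\<close>
    define A where "A = circle_char (of_int k * (\<Sum>j<l. b (\<omega> (j + m)) / real D ^ j))"
    define E where "E = (\<lambda>\<omega>'. circle_char (of_int k * (digit_series D (\<lambda>n. b (\<omega>' (n + 0))) / real D ^ l)))"
    have [measurable]: "E \<in> borel_measurable S"
      unfolding E_def by measurable
    have "F n (comb_seq n \<omega> \<omega>') = F 0 \<omega>'" for \<omega>'
      by (simp add: F_def comb_seq_def)
    moreover have "F m (comb_seq n \<omega> \<omega>') = A * E \<omega>'" if \<omega>': "\<omega>' \<in> space S" for \<omega>'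
    proof -
      have "digit_series D (\<lambda>i. b (comb_seq n \<omega> \<omega>' (i + m)))
          = (\<Sum>j<l. b (comb_seq n \<omega> \<omega>' (j + m)) / real D ^ j)
            + digit_series D (\<lambda>i. b (comb_seq n \<omega> \<omega>' (i + l + m))) / real D ^ l"
        by (rule digit_series_split[OF D_real])
           (use b_seq[OF \<omega>] b_seq[OF \<omega>'] in \<open>auto simp: comb_seq_def\<close>)
      also have "(\<Sum>j<l. b (comb_seq n \<omega> \<omega>' (j + m)) / real D ^ j) = (\<Sum>j<l. b (\<omega> (j + m)) / real D ^ j)"
        by (intro sum.cong) (auto simp: comb_seq_def l_def)
      also have "(\<lambda>i. b (comb_seq n \<omega> \<omega>' (i + l + m))) = (\<lambda>i. b (\<omega>' (i + 0)))"
        using \<open>m \<le> n\<close> by (auto simp: comb_seq_def l_def)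
      finally show ?thesis
        by (simp add: F_def A_def E_def distrib_left circle_char_add)
    qed
    ultimately have "integral\<^sup>L S ?H = (\<integral>\<omega>'. (A * E \<omega>' - \<phi>) * cnj (F 0 \<omega>' - \<phi>) \<partial>S)"
      by (intro Bochner_Integration.integral_cong) auto
    also have "\<dots> = (\<integral>\<omega>'. A * (E \<omega>' - 1) * cnj (F 0 \<omega>' - \<phi>) + (A - \<phi>) * cnj (F 0 \<omega>' - \<phi>) \<partial>S)"
      by (simp add: algebra_simps)
    also have "\<dots> = (\<integral>\<omega>'. A * (E \<omega>' - 1) * cnj (F 0 \<omega>' - \<phi>) \<partial>S) + (\<integral>\<omega>'. (A - \<phi>) * cnj (F 0 \<omega>' - \<phi>) \<partial>S)"
    proof (rule Bochner_Integration.integral_add)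
      have E: "norm (E \<omega>') = 1" for \<omega>' by (simp add: E_def)
      have A: "norm A = 1" by (simp add: A_def)
      have "norm (A * (E \<omega>' - 1) * cnj (F 0 \<omega>' - \<phi>)) \<le> 1 * 2 * 2" for \<omega>'
        unfolding norm_mult complex_mod_cnj A
        using norm_triangle_ineq4[of "E \<omega>'" 1] E[of \<omega>'] by (intro mult_mono diff_norm) auto
      then show "integrable S (\<lambda>\<omega>'. A * (E \<omega>' - 1) * cnj (F 0 \<omega>' - \<phi>))"
        by (intro integrable_const_bound[of _ "1 * 2 * 2"]) auto
      have "norm ((A - \<phi>) * cnj (F 0 \<omega>' - \<phi>)) \<le> norm (A - \<phi>) * 2" for \<omega>'
        unfolding norm_mult complex_mod_cnj by (intro mult_left_mono diff_norm) auto
      then show "integrable S (\<lambda>\<omega>'. (A - \<phi>) * cnj (F 0 \<omega>' - \<phi>))"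
        by (intro integrable_const_bound[of _ "norm (A - \<phi>) * 2"]) auto
    qed
    also have "(\<integral>\<omega>'. (A - \<phi>) * cnj (F 0 \<omega>' - \<phi>) \<partial>S) = 0"
    proof -
      have "integrable S (F 0)" by (rule integrable_const_bound[of _ 1]) (auto simp: F_norm)
      then have "(\<integral>\<omega>'. F 0 \<omega>' - \<phi> \<partial>S) = 0"
        by (simp add: \<phi>_def P.prob_space)
      then show ?thesis
        by (simp only: integral_mult_right_zero Bochner_Integration.integral_cnj) simp
    qed
    also have "norm ((\<integral>\<omega>'. A * (E \<omega>' - 1) * cnj (F 0 \<omega>' - \<phi>) \<partial>S) + 0) \<le> ?K"
      unfolding add_0_right
    proof (rule norm_integral_le_const)
      fix \<omega>' assume \<omega>': "\<omega>' \<in> space S"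
      have "norm (E \<omega>' - 1) \<le> 2 * pi * \<bar>of_int k * (digit_series D (\<lambda>n. b (\<omega>' (n + 0))) / real D ^ l)\<bar>"
        using circle_char_lipschitz[of "of_int k * (digit_series D (\<lambda>n. b (\<omega>' (n + 0))) / real D ^ l)" 0]
        by (simp add: E_def)
      also have "\<dots> = 2 * pi * (\<bar>of_int k\<bar> * (\<bar>digit_series D (\<lambda>n. b (\<omega>' (n + 0)))\<bar> * (1 / real D) ^ l))"
        by (simp add: abs_mult power_inverse divide_inverse)
      also have "\<dots> \<le> 2 * pi * (\<bar>of_int k\<bar> * (2 * B * (1 / real D) ^ l))"
        using abs_digit_series_le[OF D_real, of "\<lambda>n. b (\<omega>' (n + 0))" B] b_seq[OF \<omega>']
        by (intro mult_left_mono mult_right_mono) auto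
      finally have "norm (E \<omega>' - 1) * norm (F 0 \<omega>' - \<phi>)
          \<le> (2 * pi * (\<bar>of_int k\<bar> * (2 * B * (1 / real D) ^ l))) * 2"
        using B by (intro mult_mono diff_norm) auto
      then show "norm (A * (E \<omega>' - 1) * cnj (F 0 \<omega>' - \<phi>)) \<le> ?K"
        by (simp add: norm_mult A_def mult_ac flip: complex_cnj_diff)
    qed measurable
    finally show ?thesis .
  qed
  have "(\<integral>\<omega>. (F m \<omega> - \<phi>) * cnj (F n \<omega> - \<phi>) \<partial>S)
      = (\<integral>\<omega>. \<integral>\<omega>'. (F m (comb_seq n \<omega> \<omega>') - \<phi>) * cnj (F n (comb_seq n \<omega> \<omega>') - \<phi>) \<partial>S \<partial>S)"
  proof (rule integral_shift_decomposition[where B = "2 * 2"])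
    show "norm ((F m \<omega> - \<phi>) * cnj (F n \<omega> - \<phi>)) \<le> 2 * 2" for \<omega>
      unfolding norm_mult complex_mod_cnj by (intro mult_mono diff_norm) auto
  qed measurable
  then show ?thesis
    unfolding l_def[symmetric] by (simp only:) (intro norm_integral_le_const inner; measurable)
qed

end

text \<open>
  The character at D^m (c + y) is u m * F m, where u is the character sequence of c and F m is the
  character of the m-th shift of y. In u m * (F m - \<phi>) + \<phi> * u m, the second term averages to 0 by the
  assumption on c. Multiplication by numbers u m of modulus 1 does not change the size of
  correlations, so the first averages to 0 by the law of large numbers.
\<close>

lemma AE_weyl_add_digit_series:
  fixes D :: nat and b :: "'a \<Rightarrow> int" and B c :: real
  assumes D: "D \<ge> 2"
    and b_measurable: "b \<in> measurable M (count_space UNIV)"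
    and b_bound: "\<And>x. x \<in> space M \<Longrightarrow> \<bar>real_of_int (b x)\<bar> \<le> B"
    and c: "weyl_criterion (\<lambda>m. real D ^ m * c)"
  shows "AE \<omega> in S. weyl_criterion (\<lambda>m. real D ^ m * (c + digit_series D (\<lambda>n. b (\<omega> n))))"
proof -
  have "AE \<omega> in S. mean_zero (\<lambda>m. circle_char (of_int k * (real D ^ m * (c + digit_series D (\<lambda>n. b (\<omega> n))))))"
    if "k \<noteq> 0" for k
  proof -
    define u where "u = (\<lambda>m. circle_char (of_int k * (real D ^ m * c)))"
    define F where "F = (\<lambda>m \<omega>. circle_char (of_int k * digit_series D (\<lambda>n. b (\<omega> (n + m)))))"
    define \<phi> where "\<phi> = (\<integral>\<omega>. F 0 \<omega> \<partial>S)"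
    have [measurable]: "(\<lambda>x. real_of_int (b x)) \<in> borel_measurable M"
      using b_measurable by measurable
    have [measurable]: "circle_char \<in> borel_measurable borel"
      unfolding circle_char_def cis_conv_exp by measurable
    have F_measurable [measurable]: "F m \<in> borel_measurable S" for m
      unfolding F_def digit_series_def by measurable
    have "mean_zero u" using c that by (simp add: weyl_criterion_def u_def)
    have "AE \<omega> in S. mean_zero (\<lambda>m. u m * (F m \<omega> - \<phi>))"
    proof (rule AE_mean_zero_if_correlations_decay)
      show "norm (u m * (F m \<omega> - \<phi>)) \<le> 1 + norm \<phi>" for m \<omega>
        using norm_triangle_ineq4[of "F m \<omega>" \<phi>] by (simp add: norm_mult u_def F_def)
      show "0 \<le> 1 / real D" "1 / real D < 1" using D by auto
      obtain x where "x \<in> space M" using M.not_empty by blast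
      then have "B \<ge> 0" using b_bound[of x] by linarith
      then show "0 \<le> 8 * pi * \<bar>of_int k\<bar> * B" by simp
      fix m n :: nat assume "m \<le> n"
      have "u m * (F m \<omega> - \<phi>) * cnj (u n * (F n \<omega> - \<phi>))
          = (u m * cnj (u n)) * ((F m \<omega> - \<phi>) * cnj (F n \<omega> - \<phi>))" for \<omega>
        by (simp add: mult_ac)
      then have "norm (\<integral>\<omega>. u m * (F m \<omega> - \<phi>) * cnj (u n * (F n \<omega> - \<phi>)) \<partial>S)
          = norm (\<integral>\<omega>. (F m \<omega> - \<phi>) * cnj (F n \<omega> - \<phi>) \<partial>S)"
        by (simp only: integral_mult_right_zero norm_mult) (simp add: u_def)
      also have "\<dots> \<le> 8 * pi * \<bar>of_int k\<bar> * B * (1 / real D) ^ (n - m)"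
        unfolding F_def \<phi>_def using D b_bound \<open>m \<le> n\<close>
        by (intro shifted_character_correlations) auto
      finally show "norm (\<integral>\<omega>. u m * (F m \<omega> - \<phi>) * cnj (u n * (F n \<omega> - \<phi>)) \<partial>S)
          \<le> 8 * pi * \<bar>of_int k\<bar> * B * (1 / real D) ^ (n - m)" .
    qed measurable
    then show ?thesis
    proof (rule AE_mp, intro AE_I2 impI)
      fix \<omega> assume \<omega>: "\<omega> \<in> space S" and mz: "mean_zero (\<lambda>m. u m * (F m \<omega> - \<phi>))"
      have "circle_char (of_int k * (real D ^ m * (c + digit_series D (\<lambda>n. b (\<omega> n)))))
          = u m * (F m \<omega> - \<phi>) + \<phi> * u m" for m
      proof -
        have "\<bar>real_of_int (b (\<omega> n))\<bar> \<le> B" for n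
          using \<omega> by (intro b_bound) (auto simp: space_PiM)
        from circle_char_power_times_digit_series[OF D this, of k m]
        have "circle_char (of_int k * (real D ^ m * (c + digit_series D (\<lambda>n. b (\<omega> n))))) = u m * F m \<omega>"
          by (simp add: distrib_left circle_char_add u_def F_def)
        then show ?thesis by (simp add: algebra_simps)
      qed
      then show "mean_zero (\<lambda>m. circle_char (of_int k * (real D ^ m * (c + digit_series D (\<lambda>n. b (\<omega> n))))))"
        using mean_zero_add[OF mz mean_zero_mult_left[OF \<open>mean_zero u\<close>]] by simp
    qed
  qed
  then have "AE \<omega> in S. \<forall>k\<in>- {0}. mean_zero (\<lambda>m. circle_char (of_int k * (real D ^ m * (c + digit_series D (\<lambda>n. b (\<omega> n))))))"
    by (subst AE_ball_countable) auto
  then show ?thesis by (rule eventually_mono) (simp add: weyl_criterion_def)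
qed

end

section \<open>Self-similar measures with rationally related translations\<close>

text \<open>
  The contribution of the base point z decays like D^(-n). So the coding map can be computed from any
  base point: from 0 it is a digit series, and from a point of the attractor it is seen to take values
  in the attractor.
\<close>

lemma foldr_homotheties:
  fixes D :: real and a :: "nat \<Rightarrow> real"
  shows "foldr (\<lambda>j x. inverse D * x + a j) [0..<n] z = (\<Sum>j<n. a j / D ^ j) + z / D ^ n"
  by (induction n arbitrary: z) (simp_all add: divide_inverse algebra_simps)

lemma normal_to_base_measurable:
  assumes "D \<ge> 2"
  shows "Measurable.pred borel (normal_to_base D)"
proof -
  have [measurable]: "circle_char \<in> borel_measurable borel"
    unfolding circle_char_def cis_conv_exp by measurable
  have [measurable]: "Measurable.pred borel (\<lambda>x. mean_zero (\<lambda>m. circle_char (of_int k * (real D ^ m * x))))" for k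
    by (rule mean_zero_measurable) measurable
  have "Measurable.pred borel (\<lambda>x. weyl_criterion (\<lambda>m. real D ^ m * x))"
    unfolding weyl_criterion_def by measurable
  then show ?thesis by (simp add: normal_to_base_iff_weyl_criterion[OF assms, abs_def])
qed

lemma common_denominator:
  assumes "finite A" "\<And>i. i \<in> A \<Longrightarrow> r i \<in> (\<rat> :: real set)"
  obtains q :: nat where "q > 0" "\<And>i. i \<in> A \<Longrightarrow> real q * r i \<in> \<int>"
proof -
  have "\<exists>q::nat. q > 0 \<and> (\<forall>i\<in>A. real q * r i \<in> \<int>)"
    using assms
  proof (induction A rule: finite_induct)
    case empty
    show ?case by (intro exI[of _ 1]) simp
  next
    case (insert i A)
    then obtain q :: nat where q: "q > 0" "\<forall>j\<in>A. real q * r j \<in> \<int>" by auto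
    have "r i \<in> \<rat>" using insert by simp
    then obtain a b :: int where ab: "b > 0" "r i = of_int a / of_int b"
      by (rule Rats_cases')
    have "real (q * nat b) * r i = of_int (int q * a)"
      using ab by simp
    moreover have "real (q * nat b) * r j = of_int b * (real q * r j)" for j
      using ab by simp
    ultimately have "\<forall>j\<in>insert i A. real (q * nat b) * r j \<in> \<int>"
      using q(2) by (metis Ints_mult Ints_of_int insertE)
    then show ?case using q(1) ab(1) by (intro exI[of _ "q * nat b"]) simp
  qed
  then show ?thesis using that by blast
qed

theorem theorem7:
  fixes D k :: nat and t :: "nat \<Rightarrow> real" and f :: "nat \<Rightarrow> real \<Rightarrow> real"
    and K :: "real set" and \<mu> :: "real measure"
  assumes "D \<ge> 2"
    and "\<And>i x. f i x = inverse (real D) * x + t i"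
    and "is_attractor {1..k} f K"
    and "\<And>i j. i \<in> {1..k} \<Longrightarrow> j \<in> {1..k} \<Longrightarrow> t i - t j \<in> \<rat>"
    and "\<exists>i\<in>{1..k}. normal_to_base D (t i)"
    and "bernoulli_measure {1..k} f K \<mu>"
  shows "AE x in \<mu>. normal_to_base D x"
proof -
  note D = assms(1) and f = assms(2)
  have D_real: "real D \<ge> 2" using D by simp
  obtain P where "prob_space P" and sets_Pow: "sets P = Pow {1..k}"
    and \<mu>: "\<mu> = distr (PiM (UNIV :: nat set) (\<lambda>_. P)) (restrict_space borel K) (coding_map f)"
    using assms(6) unfolding bernoulli_measure_def by blast
  interpret prob_P: prob_space P by fact
  interpret sequence_space P ..
  have space_P: "space P = {1..k}" 
    by (rule sets_eq_imp_space_eq[of P "count_space {1..k}", unfolded space_count_space])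
       (simp only: sets_Pow sets_count_space)
  have measurable_P: "h \<in> measurable P N" if "range h \<subseteq> space N" for h :: "nat \<Rightarrow> 'c" and N
    using that sets_Pow space_P by (auto simp: measurable_def)
  have symbols: "\<omega> n \<in> {1..k}" if "\<omega> \<in> space S" for \<omega> n
    using that by (auto simp: space_PiM space_P PiE_iff)
  obtain i0 where i0: "i0 \<in> {1..k}" "normal_to_base D (t i0)" using assms(5) by blast
  define T where "T = Max ((\<lambda>i. \<bar>t i\<bar>) ` {1..k})"
  have T: "\<bar>t i\<bar> \<le> T" if "i \<in> {1..k}" for i
    unfolding T_def using that by (intro Max_ge) auto

  have coding: "coding_map f \<omega> = digit_series D (\<lambda>n. t (\<omega> n))"
    and coding_K: "coding_map f \<omega> \<in> K" if \<omega>: "\<omega> \<in> space S" for \<omega>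
  proof -
    define x where "x = (\<lambda>n z. foldr (\<lambda>j. f (\<omega> j)) [0..<n] z)"
    have x: "x n z = (\<Sum>j<n. t (\<omega> j) / real D ^ j) + z / real D ^ n" for n z
      unfolding x_def f[abs_def] by (rule foldr_homotheties)
    have "(\<lambda>n. t (\<omega> n) / real D ^ n) sums digit_series D (\<lambda>n. t (\<omega> n))"
      by (rule digit_series_sums[OF D_real T[OF symbols[OF \<omega>]]])
    then have sums: "(\<lambda>n. \<Sum>j<n. t (\<omega> j) / real D ^ j) \<longlonglongrightarrow> digit_series D (\<lambda>n. t (\<omega> n))"
      by (simp add: sums_def)
    have "(\<lambda>n. z / real D ^ n) \<longlonglongrightarrow> 0" for z
      using LIMSEQ_divide_realpow_zero[of "real D" z] D by simp
    from tendsto_add[OF sums this]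
    have lim: "(\<lambda>n. x n z) \<longlonglongrightarrow> digit_series D (\<lambda>n. t (\<omega> n))" for z
      by (simp add: x)
    then show coding: "coding_map f \<omega> = digit_series D (\<lambda>n. t (\<omega> n))"
      unfolding coding_map_def x_def[symmetric] by (intro limI) (simp add: x_def)
    have "K \<noteq> {}" and "compact K" and K_eq: "K = (\<Union>i\<in>{1..k}. f i ` K)"
      using assms(3) unfolding is_attractor_def by blast+
    then have "closed K" by (simp only: compact_imp_closed)
    have K_image: "f i z \<in> K" if "i \<in> {1..k}" "z \<in> K" for i z
      by (subst K_eq) (use that in blast)
    obtain z where "z \<in> K" using \<open>K \<noteq> {}\<close> by blast
    then have "x n z \<in> K" for n
      unfolding x_def using K_image[OF symbols[OF \<omega>]]
      by (induction n arbitrary: z) auto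
    then show "coding_map f \<omega> \<in> K"
      unfolding coding by (intro closed_sequentially[OF \<open>closed K\<close> _ lim]) auto
  qed

  have "coding_map f \<in> measurable S (restrict_space borel K)"
  proof (rule measurable_restrict_space2)
    have [measurable]: "t \<in> borel_measurable P" by (rule measurable_P) simp
    have "(\<lambda>\<omega>. digit_series D (\<lambda>n. t (\<omega> n))) \<in> borel_measurable S"
      unfolding digit_series_def by measurable
    then show "coding_map f \<in> borel_measurable S"
      using coding by (simp cong: measurable_cong)
  qed (use coding_K in auto)
  moreover have "{x \<in> space (restrict_space borel K). normal_to_base D x} \<in> sets (restrict_space borel K)"
    using measurable_restrict_space1[OF normal_to_base_measurable[OF D]] by (simp add: pred_def)
  \<comment> \<open>Membership in the attractor makes the coding map measurable into the subspace, so the push-forward can be tested on sequences.\<close>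
  ultimately have reduce: "(AE x in \<mu>. normal_to_base D x) \<longleftrightarrow> (AE \<omega> in S. normal_to_base D (coding_map f \<omega>))"
    unfolding \<mu> by (rule AE_distr_iff)

  obtain q :: nat where q: "q > 0" "\<And>i. i \<in> {1..k} \<Longrightarrow> real q * (t i - t i0) \<in> \<int>"
    using common_denominator[of "{1..k}" "\<lambda>i. t i - t i0"] assms(4) i0 by auto
  \<comment> \<open>The factor D - 1 cancels the denominator of \<Sum> D^(-n) = D / (D - 1), so that c becomes an integer multiple of t i0; the digits a remain integers.\<close>
  define a where "a = (\<lambda>i. int (D - 1) * \<lfloor>real q * (t i - t i0)\<rfloor>)"
  define Q where "Q = q * (D - 1)"
  define c where "c = real (q * D) * t i0"
  have a: "real_of_int (a i) = real Q * (t i - t i0)" if "i \<in> {1..k}" for i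
    using q(2)[OF that] D by (auto simp: a_def Q_def of_nat_diff elim!: Ints_cases)
  \<comment> \<open>Subtracting the constant digit Q * t i0, whose series is c, leaves the integer digits.\<close>
  have split: "real Q * coding_map f \<omega> = c + digit_series D (\<lambda>n. a (\<omega> n))" if \<omega>: "\<omega> \<in> space S" for \<omega>
  proof -
    have "(\<lambda>n. real Q * (t (\<omega> n) / real D ^ n)) sums (real Q * digit_series D (\<lambda>n. t (\<omega> n)))"
      by (intro sums_mult digit_series_sums[OF D_real T[OF symbols[OF \<omega>]]])
    moreover have "(\<lambda>n. real Q * t i0 / real D ^ n) sums c"
    proof -
      have "real Q * t i0 * (real D / (real D - 1)) = c"
        using D by (simp add: Q_def c_def of_nat_diff)
      then show ?thesis
        using sums_constant_digit[OF D_real, of "real Q * t i0"] by simp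
    qed
    ultimately have "(\<lambda>n. real Q * (t (\<omega> n) / real D ^ n) - real Q * t i0 / real D ^ n)
        sums (real Q * digit_series D (\<lambda>n. t (\<omega> n)) - c)"
      by (rule sums_diff)
    also have "(\<lambda>n. real Q * (t (\<omega> n) / real D ^ n) - real Q * t i0 / real D ^ n) = (\<lambda>n. a (\<omega> n) / real D ^ n)"
      using a[OF symbols[OF \<omega>]] by (simp add: diff_divide_distrib right_diff_distrib)
    finally show ?thesis
      by (simp add: coding[OF \<omega>] digit_series_def sums_iff)
  qed

  have weyl_c: "weyl_criterion (\<lambda>m. real D ^ m * c)"
    unfolding weyl_criterion_def
  proof (intro allI impI)
    fix h :: int assume "h \<noteq> 0"
    then have "h * int (q * D) \<noteq> 0" using q D by simp
    moreover have "weyl_criterion (\<lambda>m. real D ^ m * t i0)" using i0 D normal_to_base_iff_weyl_criterion by blast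
    ultimately have "mean_zero (\<lambda>m. circle_char (of_int (h * int (q * D)) * (real D ^ m * t i0)))"
      unfolding weyl_criterion_def by blast
    moreover have "of_int (h * int (q * D)) * (real D ^ m * t i0) = of_int h * (real D ^ m * c)" for m
      by (simp add: c_def)
    ultimately show "mean_zero (\<lambda>m. circle_char (of_int h * (real D ^ m * c)))" by (simp only:)
  qed
  have "AE \<omega> in S. weyl_criterion (\<lambda>m. real D ^ m * (c + digit_series D (\<lambda>n. a (\<omega> n))))"
  proof (rule AE_weyl_add_digit_series[OF D _ _ weyl_c])
    show "a \<in> measurable P (count_space UNIV)" by (rule measurable_P) simp
    show "\<bar>real_of_int (a i)\<bar> \<le> Max ((\<lambda>i. \<bar>real_of_int (a i)\<bar>) ` {1..k})" if "i \<in> space P" for i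
      using that unfolding space_P by (intro Max_ge) auto
  qed
  then have "AE \<omega> in S. normal_to_base D (coding_map f \<omega>)"
  proof (rule AE_mp, intro AE_I2 impI)
    fix \<omega> assume "\<omega> \<in> space S" "weyl_criterion (\<lambda>m. real D ^ m * (c + digit_series D (\<lambda>n. a (\<omega> n))))"
    then have "weyl_criterion (\<lambda>m. real D ^ m * (real Q * coding_map f \<omega>))" by (simp only: split)
    then show "normal_to_base D (coding_map f \<omega>)"
      using weyl_divide[OF D, of Q] q D normal_to_base_iff_weyl_criterion[OF D] by (simp add: Q_def)
  qed
  then show ?thesis by (simp only: reduce)
qed

end
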